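(* Let $p\in(1,\infty)$, $q=p/(p-1)$, and let $\varphi,f_0\in\mathcal{L}_p(\mathbb{R}^d)\cap\mathcal{P}$. Assume that for some finite $\alpha,K_1,K_2>0$, $$\int_{\mathbb{R}^d}\|x\|_2^\alpha\,\varphi(x)\,dx\le K_1$$ and $$\left[\int_{\mathbb{R}^d}|f_0(x-y)-f_0(x)|^p\,dx\right]^{1/p}\le K_2\|y\|_2^\alpha\qquad\text{for every }y\in\mathbb{R}^d.$$ Then there exists a sequence $(f_m)_{m\in\mathbb{N}}$ with $f_m\in\mathrm{co}_m(\mathcal{P}_\varphi)$ for each $m\in\mathbb{N}$, such that $$\|f_m-f_0\|_p\le\begin{cases}K\,m^{-\frac{\alpha}{\alpha q+d}}&\text{if }1<p<2,\\ K\,m^{-\frac{\alpha q}{2(\alpha q+d)}}&\text{if }2\le p<\infty,\end{cases}$$ where $K$ is a finite constant that is a function of $\alpha,K_1,K_2,p,d,\varphi$ only.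
   Context: $\mathcal{P}$ is the set of all probability density functions on $\mathbb{R}^d$ (Lebesgue-measurable, nonnegative, integrating to one). For $\varphi\in\mathcal{P}$ and $\nu>0$, $\varphi_\nu(x)=\nu^d\varphi(\nu x)$, and $\mathcal{P}_\varphi=\{x\mapsto\varphi_\nu(x-\mu) : \mu\in\mathbb{R}^d,\ \nu>0\}$ is the location-scale class of $\varphi$. For $\mathcal{Q}\subset\mathcal{P}$, $\mathrm{co}_m(\mathcal{Q})=\{\sum_{j=1}^m\pi_jq_j : q_j\in\mathcal{Q},\ \pi_j\ge0,\ \sum_{j=1}^m\pi_j=1\}$. *)

theory Defs
  imports "HOL-Analysis.Analysis"
begin

definition prob_densities :: "(real ^ 'n \<Rightarrow> real) set" where
  "prob_densities = {f. f \<in> borel_measurable lebesgue \<and> (\<forall>x. 0 \<le> f x) \<and>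
     (\<integral>\<^sup>+ x. ennreal (f x) \<partial>lebesgue) = 1}"

(* The norm takes values in [0, \<infinity>]; in particular a function whose p-th power is not
   integrable has infinite norm, which would fail for a norm based on the Bochner integral. *)
definition Lp_norm :: "real \<Rightarrow> (real ^ 'n \<Rightarrow> real) \<Rightarrow> ennreal" where
  "Lp_norm p f =
     (let I = (\<integral>\<^sup>+ x. ennreal (\<bar>f x\<bar> powr p) \<partial>lebesgue)
      in if I = \<infinity> then \<infinity> else ennreal (enn2real I powr (1 / p)))"

(* Functions, not almost-everywhere equivalence classes. *)
definition Lp_functions :: "real \<Rightarrow> (real ^ 'n \<Rightarrow> real) set" where
  "Lp_functions p = {f. f \<in> borel_measurable lebesgue \<and> Lp_norm p f < \<infinity>}"

definition dilation :: "(real ^ 'n \<Rightarrow> real) \<Rightarrow> real \<Rightarrow> real ^ 'n \<Rightarrow> real" where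
  "dilation \<phi> \<nu> x = \<nu> ^ CARD('n) * \<phi> (\<nu> *\<^sub>R x)"

definition location_scale :: "(real ^ 'n \<Rightarrow> real) \<Rightarrow> (real ^ 'n \<Rightarrow> real) set" where
  "location_scale \<phi> = {(\<lambda>x. dilation \<phi> \<nu> (x - \<mu>)) | \<mu> \<nu>. \<nu> > 0}"

(* The components q 1, ..., q m need not be distinct. *)
definition mixtures :: "nat \<Rightarrow> (real ^ 'n \<Rightarrow> real) set \<Rightarrow> (real ^ 'n \<Rightarrow> real) set" where
  "mixtures m Q = {(\<lambda>x. \<Sum>j=1..m. \<pi> j * q j x) | \<pi> q.
     (\<forall>j\<in>{1..m}. q j \<in> Q \<and> 0 \<le> \<pi> j) \<and> (\<Sum>j=1..m. \<pi> j) = 1}"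

end

theory Submission
  imports Defs
begin

text \<open>
  The proof is Maurey's empirical method: write \<open>f\<^sub>0\<close> as approximately a continuous mixture of
  members of the location-scale class, then replace the mixing law by an empirical one with
  \<open>m\<close> atoms. With \<open>d = CARD('n)\<close> and \<open>\<phi>\<^sub>\<nu> = dilation \<phi> \<nu>\<close>, put
  \<open>g(x) = \<integral> \<phi>\<^sub>\<nu>(x - \<mu>) f\<^sub>0(\<mu>) d\<mu>\<close>, and split the error into a bias \<open>g - f\<^sub>0\<close> and a sampling error.

  Bias. \<open>g - f\<^sub>0\<close> is an average over \<open>y\<close>, with weight \<open>\<phi>\<^sub>\<nu>(y)\<close>, of \<open>f\<^sub>0(\<cdot> - y) - f\<^sub>0\<close>, whose
  \<open>L\<^sub>p\<close> norm is at most \<open>K2 |y|^\<alpha>\<close>. Minkowski's integral inequality would give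
  \<open>\<parallel>g - f\<^sub>0\<parallel>\<^sub>p \<le> K2 \<integral> |y|^\<alpha> \<phi>\<^sub>\<nu>(y) dy \<le> K1 K2 \<nu>^(-\<alpha>)\<close>. It is obtained from a weighted Jensen inequality
  for the finite measure \<open>|y|^\<alpha> \<phi>\<^sub>\<nu>(y) dy\<close> followed by Tonelli (\<open>kernel_average_Lp_le\<close>).

  Sampling. Let \<open>X\<^sub>\<mu> = \<phi>\<^sub>\<nu>(\<cdot> - \<mu>) - g\<close>, which is centred when \<open>\<mu>\<close> has density \<open>f\<^sub>0\<close>. The locations are
  chosen one at a time, so that only a single random location is ever averaged over and no product
  measure occurs. The pointwise inequality \<open>powr_smoothness\<close>,
    \<open>|a + b|^p \<le> (1 + C/m) |a|^p + (a term linear in b) + C m^(r-1) |b|^p\<close>, \<open>r = max 1 (p/2)\<close>,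
  is applied with \<open>a\<close> the partial sum and \<open>b = X\<^sub>\<mu>\<close>: the linear term averages to zero, so some
  location does at least as well as the average of the other two terms. After \<open>m\<close> steps the factors
  \<open>1 + C/m\<close> have multiplied up to at most \<open>e^C\<close>, and the sum of the \<open>X\<^sub>\<mu>\<close> has \<open>p\<close>-th power integral
  of order \<open>m^r \<parallel>\<phi>\<^sub>\<nu>\<parallel>\<^sub>p^p\<close> (\<open>sampling_bound\<close>). As \<open>\<parallel>\<phi>\<^sub>\<nu>\<parallel>\<^sub>p^p = \<nu>^(d(p-1)) \<parallel>\<phi>\<parallel>\<^sub>p^p\<close>, the sampling error is of
  order \<open>m^(r/p - 1) \<nu>^(d/q)\<close>, where \<open>r/p - 1\<close> is \<open>-1/q\<close> for \<open>p < 2\<close> and \<open>-1/2\<close> for \<open>p \<ge> 2\<close>.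

  Balance. Taking \<open>\<nu> = m^\<beta>\<close> with \<open>\<beta> = 1/(\<alpha>q + d)\<close>, respectively \<open>\<beta> = q/(2(\<alpha>q + d))\<close>, makes both errors
  multiples of \<open>m^(-\<alpha>\<beta>)\<close>, which is the claimed rate.

  Tonelli needs joint measurability of \<open>(\<mu>, x) \<mapsto> \<phi>\<^sub>\<nu>(x - \<mu>)\<close>, so the analysis is done for Borel
  functions; a Lebesgue measurable density is replaced by a Borel one equal to it almost everywhere,
  which changes none of the norms because translations and dilations preserve null sets.
\<close>

section \<open>Second-order control of the power function\<close>

lemma Young_powr_pred:
  fixes p u v :: real
  assumes "p > 1" "u \<ge> 0" "v \<ge> 0"
  shows "p * (v powr (p - 1) * u) \<le> u powr p + (p - 1) * v powr p"
proof -
  have "u * v powr (p - 1) \<le> u powr p / p + (v powr (p - 1)) powr (p / (p - 1)) / (p / (p - 1))"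
    by (rule Youngs_inequality) (use assms in \<open>auto simp: field_simps\<close>)
  also have "(v powr (p - 1)) powr (p / (p - 1)) = v powr p"
    using assms by (simp add: powr_powr)
  finally have "p * (u * v powr (p - 1)) \<le> p * (u powr p / p + v powr p / (p / (p - 1)))"
    using assms by (intro mult_left_mono) auto
  also have "\<dots> = u powr p + (p - 1) * v powr p"
    using assms by (simp add: field_simps)
  finally show ?thesis by (simp add: mult_ac)
qed

text \<open>For exponent \<open>p - 1\<close> this is the derivative of \<open>|a|^p / p\<close>.\<close>

definition signed_powr :: "real \<Rightarrow> real \<Rightarrow> real" where
  "signed_powr s a = sgn a * \<bar>a\<bar> powr s"

text \<open>The graph of the convex function \<open>|x|^p\<close> lies above its tangent at \<open>y\<close>. By Young's inequality
  this needs no differentiation.\<close>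

lemma abs_powr_tangent:
  fixes p x y :: real
  assumes "p > 1"
  shows "\<bar>y\<bar> powr p + p * signed_powr (p - 1) y * (x - y) \<le> \<bar>x\<bar> powr p"
proof -
  let ?h = "signed_powr (p - 1) y"
  have "?h * x \<le> \<bar>?h * x\<bar>" by simp
  also have "\<bar>?h * x\<bar> \<le> \<bar>y\<bar> powr (p - 1) * \<bar>x\<bar>"
    by (auto simp: signed_powr_def abs_mult sgn_if)
  finally have "p * (?h * x) \<le> p * (\<bar>y\<bar> powr (p - 1) * \<bar>x\<bar>)"
    using assms by (intro mult_left_mono) auto
  also have "\<dots> \<le> \<bar>x\<bar> powr p + (p - 1) * \<bar>y\<bar> powr p"
    using assms by (intro Young_powr_pred) auto
  finally have 1: "p * (?h * x) \<le> \<bar>x\<bar> powr p + (p - 1) * \<bar>y\<bar> powr p" .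
  have "?h * y = \<bar>y\<bar> powr (p - 1) * \<bar>y\<bar>"
    by (auto simp: signed_powr_def sgn_if)
  also have "\<dots> = \<bar>y\<bar> powr p"
    by (cases "y = 0") (auto simp: powr_mult_base mult.commute)
  finally have 2: "?h * y = \<bar>y\<bar> powr p" .
  have "p * ?h * (x - y) = p * (?h * x) - p * (?h * y)" by (simp add: algebra_simps)
  then show ?thesis using 1 2 by (simp add: algebra_simps)
qed

text \<open>A fraction \<open>t\<close> in \<open>[0, 1]\<close> satisfies \<open>t \<le> t^s\<close>; apply this to the shares of \<open>u\<close> and \<open>v\<close> in \<open>u + v\<close>.\<close>

lemma powr_add_le:
  fixes s u v :: real
  assumes "0 < s" "s \<le> 1" "0 \<le> u" "0 \<le> v"
  shows "(u + v) powr s \<le> u powr s + v powr s"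
proof (cases "u + v = 0")
  case False
  then have pos: "u + v > 0" using assms by simp
  have le: "t / (u + v) \<le> (t / (u + v)) powr s" if "0 \<le> t" "t \<le> u + v" for t
  proof (cases "t = 0")
    case False
    then show ?thesis
      using powr_mono'[of s 1 "t / (u + v)"] that pos assms by (simp add: field_simps)
  qed simp
  have "1 = u / (u + v) + v / (u + v)" using pos by (simp add: add_divide_distrib [symmetric])
  also have "\<dots> \<le> (u / (u + v)) powr s + (v / (u + v)) powr s"
    using le[of u] le[of v] assms by simp
  also have "\<dots> = (u powr s + v powr s) / (u + v) powr s"
    using assms by (simp add: powr_divide add_divide_distrib)
  finally show ?thesis using pos by (simp add: field_simps)
qed (use assms in auto)

text \<open>For arguments of equal sign this is subadditivity of the power. For opposite signs both terms
  are at most \<open>|x - y|^s\<close>, which costs the factor 2.\<close>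

lemma signed_powr_diff_le_of_le_one:
  fixes s x y :: real
  assumes "0 < s" "s \<le> 1"
  shows "\<bar>signed_powr s x - signed_powr s y\<bar> \<le> 2 * \<bar>x - y\<bar> powr s"
proof -
  have same: "\<bar>u powr s - v powr s\<bar> \<le> 2 * \<bar>u - v\<bar> powr s" if "0 \<le> u" "0 \<le> v" for u v
  proof -
    have *: "b powr s \<le> a powr s \<and> a powr s \<le> b powr s + (a - b) powr s" if "0 \<le> b" "b \<le> a" for a b
      using powr_add_le[of s b "a - b"] that assms by (auto intro: powr_mono2)
    show ?thesis
    proof (cases "u \<le> v")
      case True
      then show ?thesis using *[of u v] that by (simp add: abs_if)
    next
      case False
      then show ?thesis using *[of v u] that by (simp add: abs_if)
    qed
  qed
  have opp: "u powr s + v powr s \<le> 2 * (u + v) powr s" if "0 \<le> u" "0 \<le> v" for u v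
    using powr_mono2[of s u "u + v"] powr_mono2[of s v "u + v"] that assms by simp
  have cross: "\<bar>signed_powr s u - signed_powr s v\<bar> \<le> 2 * \<bar>u - v\<bar> powr s" if "u \<ge> 0" "v < 0" for u v
    using opp[of u "-v"] that by (auto simp: signed_powr_def sgn_if)
  consider "x \<ge> 0" "y \<ge> 0" | "x < 0" "y < 0" | "x \<ge> 0" "y < 0" | "x < 0" "y \<ge> 0" by linarith
  then show ?thesis
  proof cases
    case 1
    then show ?thesis using same[of x y] by (auto simp: signed_powr_def sgn_if)
  next
    case 2
    then show ?thesis using same[of "-x" "-y"]
      by (auto simp: signed_powr_def sgn_if abs_minus_commute)
  next
    case 3
    then show ?thesis by (rule cross)
  next
    case 4
    then show ?thesis using cross[of y x] by (simp add: abs_minus_commute)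
  qed
qed

text \<open>A mean value estimate: the derivative of the signed power is at most \<open>s M^(s-1)\<close> on \<open>[-M, M]\<close>.
  It follows from the tangent inequality on each side of the origin.\<close>

lemma signed_powr_diff_le_of_ge_one:
  fixes s x y M :: real
  assumes "1 \<le> s" "\<bar>x\<bar> \<le> M" "\<bar>y\<bar> \<le> M"
  shows "\<bar>signed_powr s x - signed_powr s y\<bar> \<le> s * M powr (s - 1) * \<bar>x - y\<bar>"
proof -
  have tan: "a powr s - b powr s \<le> s * M powr (s - 1) * (a - b) \<and> b powr s \<le> a powr s"
    if "0 \<le> b" "b \<le> a" "a \<le> M" for a b
  proof (cases "s = 1 \<or> a = 0")
    case True
    then show ?thesis using that by auto
  next
    case False
    then have "s > 1" "a > 0" using assms that by auto
    have "a powr s + s * a powr (s - 1) * (b - a) \<le> b powr s"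
      using abs_powr_tangent[of s a b] \<open>s > 1\<close> \<open>a > 0\<close> that by (simp add: signed_powr_def)
    then have "a powr s - b powr s \<le> s * a powr (s - 1) * (a - b)" by (simp add: algebra_simps)
    also have "\<dots> \<le> s * M powr (s - 1) * (a - b)"
      using that \<open>s > 1\<close> by (intro mult_right_mono mult_left_mono powr_mono2) auto
    finally show ?thesis using powr_mono2[of s b a] that \<open>s > 1\<close> by simp
  qed
  have single: "a powr s \<le> s * M powr (s - 1) * a" if "0 \<le> a" "a \<le> M" for a
    using tan[of 0 a] that assms by simp
  have cross: "\<bar>signed_powr s u - signed_powr s v\<bar> \<le> s * M powr (s - 1) * \<bar>u - v\<bar>"
    if "u \<ge> 0" "v < 0" "\<bar>u\<bar> \<le> M" "\<bar>v\<bar> \<le> M" for u v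
    using single[of u] single[of "-v"] that
    by (auto simp: signed_powr_def sgn_if right_diff_distrib)
  consider "x \<ge> 0" "y \<ge> 0" "x \<ge> y" | "x \<ge> 0" "y \<ge> 0" "x < y"
    | "x < 0" "y < 0" "x \<ge> y" | "x < 0" "y < 0" "x < y" | "x \<ge> 0" "y < 0" | "x < 0" "y \<ge> 0"
    by linarith
  then show ?thesis
  proof cases
    case 1
    then show ?thesis using tan[of y x] assms by (auto simp: signed_powr_def sgn_if)
  next
    case 2
    then show ?thesis using tan[of x y] assms by (auto simp: signed_powr_def sgn_if)
  next
    case 3
    then show ?thesis using tan[of "-x" "-y"] assms
      by (auto simp: signed_powr_def sgn_if abs_if)
  next
    case 4
    then show ?thesis using tan[of "-y" "-x"] assms
      by (auto simp: signed_powr_def sgn_if abs_if)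
  next
    case 5
    then show ?thesis using cross[of x y] assms by simp
  next
    case 6
    then show ?thesis using cross[of y x] assms by (simp add: abs_minus_commute)
  qed
qed

lemma abs_add_powr_le:
  fixes a b p :: real
  assumes "p > 0"
  shows "\<bar>a + b\<bar> powr p \<le> 2 powr p * (\<bar>a\<bar> powr p + \<bar>b\<bar> powr p)"
proof -
  have "\<bar>a + b\<bar> powr p \<le> (2 * max \<bar>a\<bar> \<bar>b\<bar>) powr p"
    using assms by (intro powr_mono2) auto
  also have "\<dots> = 2 powr p * max \<bar>a\<bar> \<bar>b\<bar> powr p" by (simp add: powr_mult)
  also have "\<dots> \<le> 2 powr p * (\<bar>a\<bar> powr p + \<bar>b\<bar> powr p)"
    by (intro mult_left_mono) (auto simp: max_def)
  finally show ?thesis .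
qed

text \<open>The tangent inequality at \<open>a + b\<close> bounds the increment by the derivative at \<open>a + b\<close> times \<open>b\<close>;
  moving the derivative back to \<open>a\<close> leaves an error governed by its modulus of continuity.\<close>

lemma abs_add_powr_le_tangent:
  fixes p :: real
  assumes "p > 1"
  shows "\<bar>a + b\<bar> powr p
    \<le> \<bar>a\<bar> powr p + p * signed_powr (p - 1) a * b + p * (\<bar>signed_powr (p - 1) (a + b) - signed_powr (p - 1) a\<bar> * \<bar>b\<bar>)"
proof -
  let ?h = "signed_powr (p - 1)"
  have "\<bar>a + b\<bar> powr p \<le> \<bar>a\<bar> powr p + p * ?h (a + b) * b"
    using abs_powr_tangent[OF assms, of "a + b" a] by simp
  also have "\<dots> = \<bar>a\<bar> powr p + p * ?h a * b + p * ((?h (a + b) - ?h a) * b)"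
    by (simp add: algebra_simps)
  also have "(?h (a + b) - ?h a) * b \<le> \<bar>?h (a + b) - ?h a\<bar> * \<bar>b\<bar>"
    by (metis abs_ge_self abs_mult)
  finally show ?thesis using assms by simp
qed

text \<open>Here the second-order error is of size \<open>max(|a|, |b|)^(p-2) b^2\<close>. The mixed term
  \<open>|a|^(p-2) b^2\<close> is at most \<open>|a|^p / n\<close> if \<open>n b^2 \<le> a^2\<close>, and at most \<open>n^(p/2-1) |b|^p\<close> otherwise. Splitting
  it in this way replaces an application of Hoelder's inequality to partial sums by a factor
  \<open>1 + C/n\<close>, which is harmless over \<open>n\<close> steps.\<close>

lemma powr_smoothness_ge_two:
  fixes p :: real and n :: nat
  assumes "2 \<le> p" "n \<ge> 1"
  shows "\<bar>a + b\<bar> powr p \<le> (1 + (p * (p - 1) * 2 powr (p - 2)) / n) * \<bar>a\<bar> powr p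
    + p * signed_powr (p - 1) a * b + (p * (p - 1) * 2 powr (p - 2)) * real n powr (p / 2 - 1) * \<bar>b\<bar> powr p"
proof (cases "b = 0")
  case True
  then show ?thesis using assms by (simp add: mult_le_cancel_right1)
next
  case b: False
  define C where "C = p * (p - 1) * 2 powr (p - 2)"
  have C: "C \<ge> 0" using assms by (simp add: C_def)
  let ?M = "max \<bar>a\<bar> \<bar>b\<bar>"
  have M: "?M > 0" using b by auto
  let ?h = "signed_powr (p - 1)"
  have sq: "\<bar>b\<bar> powr (p - 2) * b\<^sup>2 = \<bar>b\<bar> powr p"
    using b powr_add[of "\<bar>b\<bar>" "p - 2" 2] by simp
  have n1: "1 \<le> real n powr (p / 2 - 1)"
    using assms by (intro ge_one_powr_ge_zero) auto
  have key: "?M powr (p - 2) * b\<^sup>2 \<le> \<bar>a\<bar> powr p / n + real n powr (p / 2 - 1) * \<bar>b\<bar> powr p"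
  proof -
    consider "\<bar>a\<bar> \<le> \<bar>b\<bar>" | "\<bar>a\<bar> > \<bar>b\<bar>" "n * b\<^sup>2 \<le> a\<^sup>2" | "\<bar>a\<bar> > \<bar>b\<bar>" "n * b\<^sup>2 > a\<^sup>2" by linarith
    then show ?thesis
    proof cases
      case 1
      have "1 * \<bar>b\<bar> powr p \<le> real n powr (p / 2 - 1) * \<bar>b\<bar> powr p"
        using n1 by (intro mult_right_mono) auto
      then show ?thesis using 1 sq by (simp add: max_absorb2 add_increasing)
    next
      case 2
      have "\<bar>a\<bar> powr (p - 2) * b\<^sup>2 \<le> \<bar>a\<bar> powr (p - 2) * (a\<^sup>2 / n)"
        using 2 assms by (intro mult_left_mono) (auto simp: field_simps)
      also have "\<dots> = \<bar>a\<bar> powr p / n"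
        using 2 powr_add[of "\<bar>a\<bar>" "p - 2" 2] by simp
      finally show ?thesis using 2 by (simp add: max_absorb1 add_increasing2)
    next
      case 3
      have "a\<^sup>2 powr (p / 2 - 1) \<le> (n * b\<^sup>2) powr (p / 2 - 1)"
        using 3 assms by (intro powr_mono2) auto
      moreover have "z\<^sup>2 powr (p / 2 - 1) = \<bar>z\<bar> powr (p - 2)" if "z \<noteq> 0" for z :: real
      proof -
        have "z\<^sup>2 = \<bar>z\<bar> powr 2" using that by simp
        then have "z\<^sup>2 powr (p / 2 - 1) = \<bar>z\<bar> powr (2 * (p / 2 - 1))" by (simp only: powr_powr)
        then show ?thesis by (simp add: algebra_simps)
      qed
      ultimately have "\<bar>a\<bar> powr (p - 2) \<le> real n powr (p / 2 - 1) * \<bar>b\<bar> powr (p - 2)"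
        using 3 b by (auto simp: powr_mult)
      then have "\<bar>a\<bar> powr (p - 2) * b\<^sup>2 \<le> real n powr (p / 2 - 1) * \<bar>b\<bar> powr (p - 2) * b\<^sup>2"
        by (intro mult_right_mono) auto
      then show ?thesis using 3 sq by (simp add: max_absorb1 add_increasing mult.assoc)
    qed
  qed
  have "\<bar>?h (a + b) - ?h a\<bar> \<le> (p - 1) * (2 * ?M) powr (p - 1 - 1) * \<bar>a + b - a\<bar>"
    using assms by (intro signed_powr_diff_le_of_ge_one) auto
  also have "\<dots> = (p - 1) * 2 powr (p - 2) * ?M powr (p - 2) * \<bar>b\<bar>"
    by (simp add: powr_mult)
  finally have "\<bar>?h (a + b) - ?h a\<bar> * \<bar>b\<bar> \<le> (p - 1) * 2 powr (p - 2) * ?M powr (p - 2) * \<bar>b\<bar> * \<bar>b\<bar>"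
    by (intro mult_right_mono) auto
  then have "p * (\<bar>?h (a + b) - ?h a\<bar> * \<bar>b\<bar>) \<le> p * ((p - 1) * 2 powr (p - 2) * ?M powr (p - 2) * \<bar>b\<bar> * \<bar>b\<bar>)"
    using assms by (intro mult_left_mono) auto
  also have "\<dots> = C * (?M powr (p - 2) * b\<^sup>2)"
    by (simp add: C_def power2_eq_square mult_ac)
  also have "\<dots> \<le> C * (\<bar>a\<bar> powr p / n + real n powr (p / 2 - 1) * \<bar>b\<bar> powr p)"
    using key C by (intro mult_left_mono) auto
  finally show ?thesis
    using abs_add_powr_le_tangent[of p a b] assms unfolding C_def[symmetric]
    by (simp add: algebra_simps)
qed

lemma powr_smoothness_le_two:
  fixes p :: real
  assumes "1 < p" "p \<le> 2"
  shows "\<bar>a + b\<bar> powr p \<le> \<bar>a\<bar> powr p + p * signed_powr (p - 1) a * b + 2 * p * \<bar>b\<bar> powr p"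
proof -
  let ?h = "signed_powr (p - 1)"
  have "\<bar>?h (a + b) - ?h a\<bar> * \<bar>b\<bar> \<le> (2 * \<bar>b\<bar> powr (p - 1)) * \<bar>b\<bar>"
    using signed_powr_diff_le_of_le_one[of "p - 1" "a + b" a] assms
    by (intro mult_right_mono) auto
  also have "\<dots> = 2 * (\<bar>b\<bar> powr (p - 1) * \<bar>b\<bar>)" by simp
  also have "\<bar>b\<bar> powr (p - 1) * \<bar>b\<bar> = \<bar>b\<bar> powr p"
    by (cases "b = 0") (auto simp: powr_mult_base mult.commute)
  finally have "p * (\<bar>?h (a + b) - ?h a\<bar> * \<bar>b\<bar>) \<le> p * (2 * \<bar>b\<bar> powr p)"
    using assms by (intro mult_left_mono) auto
  also have "\<dots> = 2 * p * \<bar>b\<bar> powr p" by simp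
  finally show ?thesis
    using abs_add_powr_le_tangent[of p a b] assms by linarith
qed

text \<open>The two ranges of \<open>p\<close> in one form, with the growth exponent \<open>r = max 1 (p/2)\<close>: one step of
  a sum of \<open>n\<close> centred terms costs \<open>n^(r-1)\<close>, hence the whole sum \<open>n^r\<close>.\<close>

lemma powr_smoothness:
  fixes p :: real
  assumes "1 < p"
  obtains C :: real where "C > 0"
    "\<And>a b (n::nat). n \<ge> 1 \<Longrightarrow> \<bar>a + b\<bar> powr p \<le> (1 + C / n) * \<bar>a\<bar> powr p
      + p * signed_powr (p - 1) a * b + C * real n powr (max 1 (p / 2) - 1) * \<bar>b\<bar> powr p"
proof (cases "p \<le> 2")
  case True
  show ?thesis
  proof (rule that[of "2 * p"])
    fix a b :: real and n :: nat
    assume n: "n \<ge> 1"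
    have "max 1 (p / 2) - 1 = 0" using True by simp
    then have "real n powr (max 1 (p / 2) - 1) = 1" using n by simp
    moreover have "\<bar>a\<bar> powr p \<le> (1 + 2 * p / n) * \<bar>a\<bar> powr p"
      using assms by (simp add: mult_le_cancel_right1)
    ultimately show "\<bar>a + b\<bar> powr p \<le> (1 + 2 * p / n) * \<bar>a\<bar> powr p
      + p * signed_powr (p - 1) a * b + 2 * p * real n powr (max 1 (p / 2) - 1) * \<bar>b\<bar> powr p"
      using powr_smoothness_le_two[OF assms True, of a b] by simp
  qed (use assms in simp)
next
  case False
  then have "max 1 (p / 2) = p / 2" by simp
  then show ?thesis
    using that[of "p * (p - 1) * 2 powr (p - 2)"] powr_smoothness_ge_two[of p] assms False
    by simp
qed

section \<open>Sampling from a probability measure, one point at a time\<close>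

text \<open>Jensen's inequality for the finite measure \<open>w dN\<close>, in the form
  \<open>(\<integral> h w)^p \<le> W^(p-1) \<integral> h^p w\<close>. Integrating the tangent inequality for \<open>t^p\<close> at \<open>a = g / W\<close> against
  \<open>w\<close> proves it for nonnegative integrals, whether or not they are finite.\<close>

lemma powr_le_weighted_nn_integral:
  fixes p W g :: real and h w :: "'a \<Rightarrow> real"
  assumes p: "p > 1"
    and [measurable]: "h \<in> borel_measurable N" "w \<in> borel_measurable N"
    and h: "\<And>x. 0 \<le> h x" and w: "\<And>x. 0 \<le> w x"
    and W: "(\<integral>\<^sup>+x. ennreal (w x) \<partial>N) \<le> ennreal W" "W > 0"
    and g: "0 \<le> g" "ennreal g \<le> (\<integral>\<^sup>+x. ennreal (h x * w x) \<partial>N)"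
  shows "ennreal (g powr p) \<le> ennreal (W powr (p - 1)) * (\<integral>\<^sup>+x. ennreal (h x powr p * w x) \<partial>N)"
proof (cases "(\<integral>\<^sup>+x. ennreal (h x powr p * w x) \<partial>N) = \<infinity>")
  case True
  have "ennreal (W powr (p - 1)) \<noteq> 0" using W by simp
  then show ?thesis using True by (simp add: ennreal_mult_eq_top_iff ennreal_mult_top)
next
  case False
  then obtain I where I: "I \<ge> 0" "(\<integral>\<^sup>+x. ennreal (h x powr p * w x) \<partial>N) = ennreal I"
    by (cases "\<integral>\<^sup>+x. ennreal (h x powr p * w x) \<partial>N" rule: ennreal_cases) auto
  define a where "a = g / W"
  have a: "a \<ge> 0" "g = a * W" using W g by (auto simp: a_def)
  have "ennreal (p * a powr (p - 1) * g) \<le> ennreal (p * a powr (p - 1)) * (\<integral>\<^sup>+x. ennreal (h x * w x) \<partial>N)"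
    using g p by (simp add: ennreal_mult mult_left_mono)
  also have "\<dots> = (\<integral>\<^sup>+x. ennreal (p * a powr (p - 1) * (h x * w x)) \<partial>N)"
    using p h w by (simp add: nn_integral_cmult [symmetric] ennreal_mult)
  also have "\<dots> \<le> (\<integral>\<^sup>+x. ennreal (h x powr p * w x) + ennreal ((p - 1) * a powr p) * ennreal (w x) \<partial>N)"
  proof (intro nn_integral_mono)
    fix x
    have "p * (a powr (p - 1) * h x) * w x \<le> (h x powr p + (p - 1) * a powr p) * w x"
      using Young_powr_pred[OF p h a(1)] w by (intro mult_right_mono) auto
    then have "p * a powr (p - 1) * (h x * w x) \<le> h x powr p * w x + (p - 1) * a powr p * w x"
      by (simp add: algebra_simps)
    then show "ennreal (p * a powr (p - 1) * (h x * w x))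
        \<le> ennreal (h x powr p * w x) + ennreal ((p - 1) * a powr p) * ennreal (w x)"
      using p w by (simp add: ennreal_mult [symmetric] ennreal_plus [symmetric] ennreal_leI del: ennreal_plus)
  qed
  also have "\<dots> = ennreal I + ennreal ((p - 1) * a powr p) * (\<integral>\<^sup>+x. ennreal (w x) \<partial>N)"
    by (simp add: nn_integral_add nn_integral_cmult I)
  also have "\<dots> \<le> ennreal I + ennreal ((p - 1) * a powr p) * ennreal W"
    using W by (intro add_left_mono mult_left_mono) auto
  also have "\<dots> = ennreal (I + (p - 1) * a powr p * W)"
    using p I W by (simp add: ennreal_mult [symmetric] ennreal_plus [symmetric] del: ennreal_plus)
  finally have "p * a powr (p - 1) * g \<le> I + (p - 1) * a powr p * W"
    using p I W by (subst (asm) ennreal_le_iff) (auto intro!: add_nonneg_nonneg)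
  moreover have "a powr (p - 1) * g = a powr p * W"
    using a by (cases "a = 0") (auto simp: powr_mult_base [symmetric] powr_diff)
  then have "p * a powr (p - 1) * g = p * (a powr p * W)" by simp
  moreover have "(p - 1) * a powr p * W = p * (a powr p * W) - a powr p * W"
    by (simp add: algebra_simps)
  ultimately have "a powr p * W \<le> I"
    by linarith
  then have "W powr (p - 1) * (a powr p * W) \<le> W powr (p - 1) * I"
    by (intro mult_left_mono) auto
  also have "W powr (p - 1) * (a powr p * W) = g powr p"
    using a W by (simp add: powr_mult powr_diff)
  finally show ?thesis
    using I by (simp add: ennreal_mult [symmetric] ennreal_leI)
qed

text \<open>The centred variable integrates to zero, so the linear term disappears. Centring is paid for by
  the factor \<open>2^p * 2\<close>: one power of two from splitting \<open>F - \<integral> F\<close>, and one copy of the moment of \<open>F\<close> for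
  each part, by Jensen. If \<open>F\<close> has infinite \<open>p\<close>-th moment, the right-hand side is infinite because
  \<open>D > 0\<close>.\<close>

lemma nn_integral_centered_powr_le:
  fixes F :: "'a \<Rightarrow> real" and p a A k D :: real
  assumes p: "p > 1" and prob: "emeasure M (space M) = 1"
    and F [measurable]: "F \<in> borel_measurable M"
    and A: "A \<ge> 0" and D: "D > 0"
    and smooth: "\<And>b. \<bar>a + b\<bar> powr p \<le> A + k * b + D * \<bar>b\<bar> powr p"
  shows "(\<integral>\<^sup>+y. ennreal (\<bar>a + (F y - (\<integral>z. F z \<partial>M))\<bar> powr p) \<partial>M)
    \<le> ennreal A + ennreal (D * (2 powr p * 2)) * (\<integral>\<^sup>+y. ennreal (\<bar>F y\<bar> powr p) \<partial>M)"
proof (cases "(\<integral>\<^sup>+y. ennreal (\<bar>F y\<bar> powr p) \<partial>M) = \<infinity>")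
  case True
  have "ennreal (D * (2 powr p * 2)) \<noteq> 0" using D by (simp add: ennreal_eq_0_iff not_le)
  then show ?thesis using True by (simp add: ennreal_mult_eq_top_iff ennreal_mult_top)
next
  case False
  interpret finite_measure M
    by standard (simp add: prob)
  define g where "g = (\<integral>z. F z \<partial>M)"
  have meas1: "measure M (space M) = 1" using prob by (simp add: measure_def)
  have iP: "integrable M (\<lambda>y. \<bar>F y\<bar> powr p)"
    using False by (intro integrableI_bounded) (auto simp: less_top)
  have iF: "integrable M F"
  proof (rule Bochner_Integration.integrable_bound[of M "\<lambda>y. 1 + \<bar>F y\<bar> powr p"])
    have "t \<le> 1 + t powr p" if "t \<ge> 0" for t
    proof (cases "t \<le> 1")
      case False
      then show ?thesis using powr_mono[of 1 p t] p by simp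
    qed (simp add: add_increasing2)
    then show "AE y in M. norm (F y) \<le> norm (1 + \<bar>F y\<bar> powr p)" by auto
  qed (use iP in auto)
  define I where "I = (\<integral>y. \<bar>F y\<bar> powr p \<partial>M)"
  have I: "(\<integral>\<^sup>+y. ennreal (\<bar>F y\<bar> powr p) \<partial>M) = ennreal I" "I \<ge> 0"
    unfolding I_def using iP by (auto intro!: nn_integral_eq_integral)
  have "ennreal (\<bar>g\<bar> powr p) \<le> ennreal (1 powr (p - 1)) * (\<integral>\<^sup>+y. ennreal (\<bar>F y\<bar> powr p * 1) \<partial>M)"
    using p prob integral_norm_bound_ennreal[OF iF]
    by (intro powr_le_weighted_nn_integral) (auto simp: g_def)
  then have gI: "\<bar>g\<bar> powr p \<le> I" using I by simp
  let ?X = "\<lambda>y. F y - g"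
  have iX: "integrable M ?X" using iF by simp
  have X0: "(\<integral>y. ?X y \<partial>M) = 0" using iF by (simp add: g_def meas1)
  have bX: "\<bar>?X y\<bar> powr p \<le> 2 powr p * (\<bar>F y\<bar> powr p + \<bar>g\<bar> powr p)" for y
    using abs_add_powr_le[of p "F y" "- g"] p by simp
  have iXb: "integrable M (\<lambda>y. 2 powr p * (\<bar>F y\<bar> powr p + \<bar>g\<bar> powr p))"
    using iP by simp
  have iXp: "integrable M (\<lambda>y. \<bar>?X y\<bar> powr p)"
    by (rule Bochner_Integration.integrable_bound[OF iXb]) (use bX in auto)
  have "(\<integral>y. \<bar>?X y\<bar> powr p \<partial>M) \<le> (\<integral>y. 2 powr p * (\<bar>F y\<bar> powr p + \<bar>g\<bar> powr p) \<partial>M)"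
    by (intro integral_mono iXp iXb bX)
  also have "\<dots> = 2 powr p * (I + \<bar>g\<bar> powr p)"
    using iP by (simp add: I_def meas1)
  also have "\<dots> \<le> 2 powr p * (I + I)"
    using gI by (intro mult_left_mono add_left_mono) auto
  finally have EX: "(\<integral>y. \<bar>?X y\<bar> powr p \<partial>M) \<le> 2 powr p * 2 * I" by simp
  have iR: "integrable M (\<lambda>y. A + k * ?X y + D * \<bar>?X y\<bar> powr p)"
    using iX iXp by (intro Bochner_Integration.integrable_add integrable_mult_right) auto
  have "(\<integral>\<^sup>+y. ennreal (\<bar>a + ?X y\<bar> powr p) \<partial>M)
      \<le> (\<integral>\<^sup>+y. ennreal (A + k * ?X y + D * \<bar>?X y\<bar> powr p) \<partial>M)"
    by (intro nn_integral_mono ennreal_leI smooth)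
  also have "\<dots> = ennreal (\<integral>y. A + k * ?X y + D * \<bar>?X y\<bar> powr p \<partial>M)"
    using order_trans[OF powr_ge_zero smooth] iR by (intro nn_integral_eq_integral) auto
  also have "(\<integral>y. A + k * ?X y + D * \<bar>?X y\<bar> powr p \<partial>M) = A + D * (\<integral>y. \<bar>?X y\<bar> powr p \<partial>M)"
  proof -
    have "(\<integral>y. A + k * ?X y + D * \<bar>?X y\<bar> powr p \<partial>M)
        = (\<integral>y. A + k * ?X y \<partial>M) + (\<integral>y. D * \<bar>?X y\<bar> powr p \<partial>M)"
      using iX iXp by (intro Bochner_Integration.integral_add Bochner_Integration.integrable_add integrable_mult_right) auto
    also have "(\<integral>y. A + k * ?X y \<partial>M) = (\<integral>y. A \<partial>M) + (\<integral>y. k * ?X y \<partial>M)"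
      using iX by (intro Bochner_Integration.integral_add integrable_mult_right) auto
    finally show ?thesis using X0 by (simp add: meas1)
  qed
  also have "ennreal \<dots> \<le> ennreal (A + D * (2 powr p * 2 * I))"
    using EX D by (intro ennreal_leI add_left_mono mult_left_mono) auto
  also have "\<dots> = ennreal A + ennreal (D * (2 powr p * 2)) * ennreal I"
    using A D I by (simp add: ennreal_mult [symmetric] ennreal_plus [symmetric] mult_ac del: ennreal_plus)
  finally show ?thesis unfolding I(1) g_def by simp
qed

lemma exists_le_of_nn_integral_le:
  assumes prob: "emeasure M (space M) = 1"
    and [measurable]: "f \<in> borel_measurable M"
    and le: "(\<integral>\<^sup>+y. f y \<partial>M) \<le> R"
  shows "\<exists>y\<in>space M. f y \<le> R"
proof (rule ccontr)
  assume "\<not> ?thesis"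
  then have gt: "R < f y" if "y \<in> space M" for y using that by force
  then have "R \<noteq> \<infinity>" using prob by (metis emeasure_empty ex_in_conv infinity_ennreal_def not_less_iff_gr_or_eq top.not_eq_extremum zero_neq_one)
  have "(\<integral>\<^sup>+y. R \<partial>M) < (\<integral>\<^sup>+y. f y \<partial>M)"
  proof (rule nn_integral_less)
    show "(\<integral>\<^sup>+y. R \<partial>M) \<noteq> \<infinity>" using \<open>R \<noteq> \<infinity>\<close> prob by simp
    show "AE y in M. R \<le> f y" using gt by (auto intro: less_imp_le)
    show "\<not> (AE y in M. f y \<le> R)"
    proof
      assume "AE y in M. f y \<le> R"
      then have "AE y in M. False"
        by (rule AE_mp) (use gt in \<open>auto simp: not_le\<close>)
      then have "emeasure M {y \<in> space M. True} = 0" by (intro emeasure_eq_0_AE) simp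
      then show False using prob by simp
    qed
  qed auto
  then show False using le prob by simp
qed

text \<open>By Tonelli, the average over \<open>y\<close> of the integrals on the left is the integral over \<open>x\<close> of the
  averages bounded pointwise by \<open>nn_integral_centered_powr_le\<close>. Some \<open>y\<close> is at most the average.\<close>

lemma sampling_step:
  fixes F :: "'a \<Rightarrow> 'b \<Rightarrow> real" and S :: "'b \<Rightarrow> real" and p D c B :: real and k :: "'b \<Rightarrow> real"
  assumes p: "p > 1" and prob: "emeasure M (space M) = 1" and sf: "sigma_finite_measure N"
    and F [measurable]: "(\<lambda>(y, x). F y x) \<in> borel_measurable (M \<Otimes>\<^sub>M N)"
    and S [measurable]: "S \<in> borel_measurable N"
    and c: "c \<ge> 0" and D: "D > 0" and B: "B \<ge> 0"
    and smooth: "\<And>x b. \<bar>S x + b\<bar> powr p \<le> c * \<bar>S x\<bar> powr p + k x * b + D * \<bar>b\<bar> powr p"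
    and bound: "\<And>y. y \<in> space M \<Longrightarrow> (\<integral>\<^sup>+x. ennreal (\<bar>F y x\<bar> powr p) \<partial>N) \<le> ennreal B"
  shows "\<exists>y\<in>space M. (\<integral>\<^sup>+x. ennreal (\<bar>S x + (F y x - (\<integral>z. F z x \<partial>M))\<bar> powr p) \<partial>N)
     \<le> ennreal c * (\<integral>\<^sup>+x. ennreal (\<bar>S x\<bar> powr p) \<partial>N) + ennreal (D * (2 powr p * 2) * B)"
proof -
  interpret M: finite_measure M by standard (simp add: prob)
  interpret N: sigma_finite_measure N by fact
  interpret P: pair_sigma_finite M N ..
  have F' [measurable]: "(\<lambda>(x, y). F y x) \<in> borel_measurable (N \<Otimes>\<^sub>M M)"
    using measurable_pair_swap[OF F] by (simp add: case_prod_beta')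
  have [measurable]: "(\<lambda>x. \<integral>z. F z x \<partial>M) \<in> borel_measurable N" by measurable
  let ?X = "\<lambda>y x. \<bar>S x + (F y x - (\<integral>z. F z x \<partial>M))\<bar> powr p"
  let ?R = "ennreal c * (\<integral>\<^sup>+x. ennreal (\<bar>S x\<bar> powr p) \<partial>N) + ennreal (D * (2 powr p * 2) * B)"
  have [measurable]: "(\<lambda>y. F y x) \<in> borel_measurable M" if "x \<in> space N" for x
    using that by measurable
  have "(\<integral>\<^sup>+y. (\<integral>\<^sup>+x. ennreal (?X y x) \<partial>N) \<partial>M) = (\<integral>\<^sup>+x. (\<integral>\<^sup>+y. ennreal (?X y x) \<partial>M) \<partial>N)"
    by (intro P.Fubini'[symmetric]) measurable
  also have "\<dots> \<le> (\<integral>\<^sup>+x. ennreal (c * \<bar>S x\<bar> powr p)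
      + ennreal (D * (2 powr p * 2)) * (\<integral>\<^sup>+y. ennreal (\<bar>F y x\<bar> powr p) \<partial>M) \<partial>N)"
  proof (intro nn_integral_mono)
    fix x assume "x \<in> space N"
    then show "(\<integral>\<^sup>+y. ennreal (?X y x) \<partial>M) \<le> ennreal (c * \<bar>S x\<bar> powr p)
      + ennreal (D * (2 powr p * 2)) * (\<integral>\<^sup>+y. ennreal (\<bar>F y x\<bar> powr p) \<partial>M)"
      using c by (intro nn_integral_centered_powr_le[where k = "k x"] p prob D smooth) auto
  qed
  also have "\<dots> = (\<integral>\<^sup>+x. ennreal c * ennreal (\<bar>S x\<bar> powr p) \<partial>N)
      + ennreal (D * (2 powr p * 2)) * (\<integral>\<^sup>+x. (\<integral>\<^sup>+y. ennreal (\<bar>F y x\<bar> powr p) \<partial>M) \<partial>N)"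
    using c by (subst nn_integral_add) (simp_all add: nn_integral_cmult ennreal_mult)
  also have "\<dots> = ennreal c * (\<integral>\<^sup>+x. ennreal (\<bar>S x\<bar> powr p) \<partial>N)
      + ennreal (D * (2 powr p * 2)) * (\<integral>\<^sup>+y. (\<integral>\<^sup>+x. ennreal (\<bar>F y x\<bar> powr p) \<partial>N) \<partial>M)"
    by (subst P.Fubini') (simp_all add: nn_integral_cmult)
  also have "\<dots> \<le> ennreal c * (\<integral>\<^sup>+x. ennreal (\<bar>S x\<bar> powr p) \<partial>N)
      + ennreal (D * (2 powr p * 2)) * (\<integral>\<^sup>+y. ennreal B \<partial>M)"
    by (intro add_left_mono mult_left_mono nn_integral_mono bound) auto
  also have "\<dots> = ?R"
    using D B by (simp add: prob ennreal_mult)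
  finally have le: "(\<integral>\<^sup>+y. (\<integral>\<^sup>+x. ennreal (?X y x) \<partial>N) \<partial>M) \<le> ?R" .
  show ?thesis
    by (rule exists_le_of_nn_integral_le[OF prob _ le]) measurable
qed

text \<open>A derandomised form of the von Bahr--Esseen inequality (\<open>p \<le> 2\<close>) and the
  Marcinkiewicz--Zygmund inequality (\<open>p \<ge> 2\<close>) for sums of \<open>n\<close> centred independent variables with
  values in \<open>L\<^sub>p\<close>. After \<open>k\<close> steps the bound is \<open>k c^k E\<close>, where \<open>c = 1 + C/n\<close> and \<open>E\<close> is the cost of one
  step; at \<open>k = n\<close> the factor \<open>c^n\<close> is at most \<open>e^C\<close>.\<close>

lemma sampling_bound:
  fixes F :: "'a \<Rightarrow> 'b \<Rightarrow> real" and p r C B :: real and n :: nat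
  assumes p: "p > 1" and prob: "emeasure M (space M) = 1" and sf: "sigma_finite_measure N"
    and F [measurable]: "(\<lambda>(y, x). F y x) \<in> borel_measurable (M \<Otimes>\<^sub>M N)"
    and C: "C > 0" and B: "B \<ge> 0" and n: "n \<ge> 1"
    and smooth: "\<And>a b. \<bar>a + b\<bar> powr p \<le> (1 + C / n) * \<bar>a\<bar> powr p
      + p * signed_powr (p - 1) a * b + C * real n powr (r - 1) * \<bar>b\<bar> powr p"
    and bound: "\<And>y. y \<in> space M \<Longrightarrow> (\<integral>\<^sup>+x. ennreal (\<bar>F y x\<bar> powr p) \<partial>N) \<le> ennreal B"
  shows "\<exists>y. (\<forall>j. y j \<in> space M) \<and>
    (\<integral>\<^sup>+x. ennreal (\<bar>\<Sum>j=1..n. F (y j) x - (\<integral>z. F z x \<partial>M)\<bar> powr p) \<partial>N)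
      \<le> ennreal (C * exp C * (2 powr p * 2) * real n powr r * B)"
proof -
  interpret M: finite_measure M by standard (simp add: prob)
  have F' [measurable]: "(\<lambda>(x, y). F y x) \<in> borel_measurable (N \<Otimes>\<^sub>M M)"
    using measurable_pair_swap[OF F] by (simp add: case_prod_beta')
  define g where "g = (\<lambda>x. \<integral>z. F z x \<partial>M)"
  have [measurable]: "g \<in> borel_measurable N" unfolding g_def by measurable
  define c where "c = 1 + C / n"
  have c: "c \<ge> 1" using C n by (simp add: c_def)
  define E where "E = C * real n powr (r - 1) * (2 powr p * 2) * B"
  have E: "E \<ge> 0" using C B by (simp add: E_def)
  \<comment> \<open>A filler for the positions beyond those chosen so far.\<close>
  obtain y0 where y0: "y0 \<in> space M" using prob by (metis emeasure_empty ex_in_conv zero_neq_one)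
  have step: "\<exists>y. (\<forall>j. y j \<in> space M) \<and>
    (\<integral>\<^sup>+x. ennreal (\<bar>\<Sum>j=1..k. F (y j) x - g x\<bar> powr p) \<partial>N) \<le> ennreal (k * c ^ k * E)" for k :: nat
  proof (induction k)
    case 0
    show ?case using y0 by (intro exI[of _ "\<lambda>_. y0"]) simp
  next
    case (Suc k)
    then obtain y where y: "\<And>j. y j \<in> space M"
      and le: "(\<integral>\<^sup>+x. ennreal (\<bar>\<Sum>j=1..k. F (y j) x - g x\<bar> powr p) \<partial>N) \<le> ennreal (k * c ^ k * E)"
      by blast
    define S where "S = (\<lambda>x. \<Sum>j=1..k. F (y j) x - g x)"
    have [measurable]: "F (y j) \<in> borel_measurable N" for j
      using measurable_compose_Pair1[OF y F] by simp
    have S: "S \<in> borel_measurable N" unfolding S_def by measurable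
    have "\<exists>z\<in>space M. (\<integral>\<^sup>+x. ennreal (\<bar>S x + (F z x - (\<integral>z. F z x \<partial>M))\<bar> powr p) \<partial>N)
       \<le> ennreal c * (\<integral>\<^sup>+x. ennreal (\<bar>S x\<bar> powr p) \<partial>N)
         + ennreal (C * real n powr (r - 1) * (2 powr p * 2) * B)"
      by (rule sampling_step[OF p prob sf F S _ _ B, where k = "\<lambda>x. p * signed_powr (p - 1) (S x)"])
        (use c C n smooth bound in \<open>auto simp: c_def\<close>)
    then obtain z where z: "z \<in> space M"
      and lez: "(\<integral>\<^sup>+x. ennreal (\<bar>S x + (F z x - g x)\<bar> powr p) \<partial>N)
       \<le> ennreal c * (\<integral>\<^sup>+x. ennreal (\<bar>S x\<bar> powr p) \<partial>N) + ennreal E"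
      unfolding g_def E_def by blast
    define y' where "y' = y(Suc k := z)"
    have "(\<Sum>j=1..Suc k. F (y' j) x - g x) = S x + (F z x - g x)" for x
      by (simp add: S_def y'_def)
    then have "(\<integral>\<^sup>+x. ennreal (\<bar>\<Sum>j=1..Suc k. F (y' j) x - g x\<bar> powr p) \<partial>N)
       \<le> ennreal c * (\<integral>\<^sup>+x. ennreal (\<bar>S x\<bar> powr p) \<partial>N) + ennreal E"
      using lez by (simp only:)
    also have "\<dots> \<le> ennreal c * ennreal (k * c ^ k * E) + ennreal E"
      using le by (intro add_right_mono mult_left_mono) (auto simp: S_def)
    also have "\<dots> = ennreal (c * (k * c ^ k * E) + E)"
    proof -
      have "0 \<le> c" "0 \<le> k * c ^ k * E" using c E by auto
      then show ?thesis
        using E by (simp only: ennreal_mult [symmetric] ennreal_plus [symmetric] mult_nonneg_nonneg)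
    qed
    also have "\<dots> \<le> ennreal (Suc k * c ^ Suc k * E)"
    proof (rule ennreal_leI)
      have "1 * E \<le> c ^ Suc k * E" using c E one_le_power[of c "Suc k"] by (intro mult_right_mono) auto
      then show "c * (k * c ^ k * E) + E \<le> Suc k * c ^ Suc k * E" by (simp add: algebra_simps)
    qed
    finally show ?case
      using y z by (intro exI[of _ y']) (auto simp: y'_def)
  qed
  have "c ^ n \<le> exp C"
    unfolding c_def using C n by (intro exp_ge_one_plus_x_over_n_power_n) auto
  then have "n * c ^ n * E \<le> n * exp C * E"
    using E by (intro mult_right_mono mult_left_mono) auto
  also have "\<dots> = C * exp C * (2 powr p * 2) * (n * real n powr (r - 1)) * B"
    by (simp add: E_def mult_ac)
  also have "n * real n powr (r - 1) = real n powr r"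
    using n by (simp add: powr_mult_base)
  finally show ?thesis using step[of n] unfolding g_def by (meson ennreal_leI order_trans)
qed

section \<open>Translations, dilations and smoothing on Euclidean space\<close>

lemma nn_integral_lborel_affine:
  fixes f :: "'a::euclidean_space \<Rightarrow> ennreal"
  assumes [measurable]: "f \<in> borel_measurable borel" and c: "c \<noteq> 0"
  shows "(\<integral>\<^sup>+x. f x \<partial>lborel) = ennreal (\<bar>c\<bar> ^ DIM('a)) * (\<integral>\<^sup>+x. f (t + c *\<^sub>R x) \<partial>lborel)"
  by (subst lborel_affine[OF c, of t])
     (simp add: nn_integral_density nn_integral_distr nn_integral_cmult ennreal_power)

lemma nn_integral_lborel_shift:
  fixes f :: "'a::euclidean_space \<Rightarrow> ennreal"
  assumes "f \<in> borel_measurable borel"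
  shows "(\<integral>\<^sup>+x. f (x - t) \<partial>lborel) = (\<integral>\<^sup>+x. f x \<partial>lborel)"
  using nn_integral_lborel_affine[OF assms, of 1 "- t"] by simp

text \<open>The set where \<open>P\<close> fails need not be Borel, so it is enclosed in a Borel null set before
  the change of variables is applied.\<close>

lemma AE_lborel_affine:
  fixes P :: "'a::euclidean_space \<Rightarrow> bool"
  assumes P: "AE x in lborel. P x" and c: "c \<noteq> 0"
  shows "AE x in lborel. P (t + c *\<^sub>R x)"
proof -
  obtain N where N: "{x \<in> space lborel. \<not> P x} \<subseteq> N" "emeasure lborel N = 0" "N \<in> sets lborel"
    using AE_E[OF P] .
  have [measurable]: "N \<in> sets borel" using N by simp
  have "ennreal (\<bar>c\<bar> ^ DIM('a)) * (\<integral>\<^sup>+x. indicator N (t + c *\<^sub>R x) \<partial>lborel)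
      = (\<integral>\<^sup>+x. indicator N x \<partial>(lborel :: 'a measure))"
    by (rule nn_integral_lborel_affine[symmetric]) (use c in auto)
  also have "\<dots> = 0" using N by simp
  finally have "(\<integral>\<^sup>+x. indicator N (t + c *\<^sub>R x) \<partial>(lborel :: 'a measure)) = (0 :: ennreal)"
    using c by simp
  then have "AE x in lborel. (indicator N (t + c *\<^sub>R x) :: ennreal) = 0"
    by (subst (asm) nn_integral_0_iff_AE) auto
  then show ?thesis
    by (rule AE_mp) (use N in \<open>auto simp: indicator_def\<close>)
qed

text \<open>If \<open>\<phi>\<close> is the density of a random vector \<open>X\<close>, its dilation is the density of \<open>X / \<nu>\<close>.\<close>

lemma nn_integral_dilation:
  fixes \<phi> :: "real ^ 'n \<Rightarrow> real" and G :: "real ^ 'n \<Rightarrow> ennreal"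
  assumes \<phi> [measurable]: "\<phi> \<in> borel_measurable borel" and G [measurable]: "G \<in> borel_measurable borel"
    and \<nu>: "\<nu> > 0"
  shows "(\<integral>\<^sup>+x. G (\<nu> *\<^sub>R x) * ennreal (dilation \<phi> \<nu> x) \<partial>lborel) = (\<integral>\<^sup>+x. G x * ennreal (\<phi> x) \<partial>lborel)"
proof -
  have "(\<integral>\<^sup>+x. G x * ennreal (\<phi> x) \<partial>lborel)
      = ennreal (\<nu> ^ CARD('n)) * (\<integral>\<^sup>+x. G (\<nu> *\<^sub>R x) * ennreal (\<phi> (\<nu> *\<^sub>R x)) \<partial>lborel)"
    using nn_integral_lborel_affine[of "\<lambda>x. G x * ennreal (\<phi> x)" \<nu> 0] \<nu> by simp
  also have "\<dots> = (\<integral>\<^sup>+x. G (\<nu> *\<^sub>R x) * ennreal (dilation \<phi> \<nu> x) \<partial>lborel)"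
    using \<nu> by (subst nn_integral_cmult [symmetric])
      (auto intro!: nn_integral_cong simp: dilation_def ennreal_mult' mult_ac)
  finally show ?thesis ..
qed

lemma measurable_dilation [measurable]:
  fixes \<phi> :: "real ^ 'n \<Rightarrow> real"
  assumes [measurable]: "\<phi> \<in> borel_measurable borel"
  shows "dilation \<phi> \<nu> \<in> borel_measurable borel"
  unfolding dilation_def by measurable

text \<open>The factor \<open>\<nu>^d\<close> in the dilation is raised to the power \<open>p\<close>, and the change of variables takes
  one factor \<open>\<nu>^d\<close> back.\<close>

lemma nn_integral_dilation_powr:
  fixes \<phi> :: "real ^ 'n \<Rightarrow> real" and p :: real
  assumes [measurable]: "\<phi> \<in> borel_measurable borel" and \<nu>: "\<nu> > 0"
  shows "(\<integral>\<^sup>+x. ennreal (\<bar>dilation \<phi> \<nu> (x - t)\<bar> powr p) \<partial>lborel)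
    = ennreal (\<nu> powr (CARD('n) * (p - 1))) * (\<integral>\<^sup>+x. ennreal (\<bar>\<phi> x\<bar> powr p) \<partial>lborel)"
proof -
  let ?d = "real CARD('n)"
  have "(\<integral>\<^sup>+x. ennreal (\<bar>dilation \<phi> \<nu> (x - t)\<bar> powr p) \<partial>lborel)
      = (\<integral>\<^sup>+x. ennreal (\<bar>dilation \<phi> \<nu> x\<bar> powr p) \<partial>lborel)"
    by (rule nn_integral_lborel_shift) measurable
  also have "\<dots> = (\<integral>\<^sup>+x. ennreal (\<nu> powr (?d * (p - 1))) * (ennreal (\<nu> powr ?d) * ennreal (\<bar>\<phi> (\<nu> *\<^sub>R x)\<bar> powr p)) \<partial>lborel)"
  proof (intro nn_integral_cong)
    fix x
    have "\<nu> ^ CARD('n) = \<nu> powr ?d" using \<nu> by (simp add: powr_realpow)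
    then have "\<bar>dilation \<phi> \<nu> x\<bar> powr p = \<nu> powr (?d * p) * \<bar>\<phi> (\<nu> *\<^sub>R x)\<bar> powr p"
      using \<nu> by (simp add: dilation_def abs_mult powr_mult powr_powr)
    also have "\<nu> powr (?d * p) = \<nu> powr (?d * (p - 1)) * \<nu> powr ?d"
      by (simp add: powr_add [symmetric] algebra_simps)
    finally show "ennreal (\<bar>dilation \<phi> \<nu> x\<bar> powr p) =
      ennreal (\<nu> powr (?d * (p - 1))) * (ennreal (\<nu> powr ?d) * ennreal (\<bar>\<phi> (\<nu> *\<^sub>R x)\<bar> powr p))"
      by (simp add: ennreal_mult mult_ac)
  qed
  also have "\<dots> = ennreal (\<nu> powr (?d * (p - 1)))
      * (ennreal (\<nu> ^ CARD('n)) * (\<integral>\<^sup>+x. ennreal (\<bar>\<phi> (\<nu> *\<^sub>R x)\<bar> powr p) \<partial>lborel))"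
    using \<nu> by (simp add: nn_integral_cmult powr_realpow)
  also have "ennreal (\<nu> ^ CARD('n)) * (\<integral>\<^sup>+x. ennreal (\<bar>\<phi> (\<nu> *\<^sub>R x)\<bar> powr p) \<partial>lborel)
      = (\<integral>\<^sup>+x. ennreal (\<bar>\<phi> x\<bar> powr p) \<partial>lborel)"
    using nn_integral_lborel_affine[of "\<lambda>x. ennreal (\<bar>\<phi> x\<bar> powr p)" \<nu> 0] \<nu> by simp
  finally show ?thesis .
qed

lemma nn_integral_norm_powr_dilation:
  fixes \<phi> :: "real ^ 'n \<Rightarrow> real"
  assumes [measurable]: "\<phi> \<in> borel_measurable borel" and \<phi>: "\<And>x. 0 \<le> \<phi> x"
    and \<nu>: "\<nu> > 0"
  shows "(\<integral>\<^sup>+x. ennreal (norm x powr \<alpha> * dilation \<phi> \<nu> x) \<partial>lborel)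
    = ennreal (\<nu> powr (- \<alpha>)) * (\<integral>\<^sup>+x. ennreal (norm x powr \<alpha> * \<phi> x) \<partial>lborel)"
proof -
  have "(\<integral>\<^sup>+x. ennreal (norm x powr \<alpha> * dilation \<phi> \<nu> x) \<partial>lborel)
     = (\<integral>\<^sup>+x. ennreal (\<nu> powr (- \<alpha>) * norm (\<nu> *\<^sub>R x) powr \<alpha>) * ennreal (dilation \<phi> \<nu> x) \<partial>lborel)"
    using \<nu> \<phi> by (intro nn_integral_cong)
      (simp add: ennreal_mult [symmetric] dilation_def powr_mult powr_minus field_simps)
  also have "\<dots> = (\<integral>\<^sup>+x. ennreal (\<nu> powr (- \<alpha>) * norm x powr \<alpha>) * ennreal (\<phi> x) \<partial>lborel)"
    by (intro nn_integral_dilation[of _ "\<lambda>x. ennreal (\<nu> powr (- \<alpha>) * norm x powr \<alpha>)"] \<nu>) measurable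
  also have "\<dots> = ennreal (\<nu> powr (- \<alpha>)) * (\<integral>\<^sup>+x. ennreal (norm x powr \<alpha> * \<phi> x) \<partial>lborel)"
    using \<phi> by (subst nn_integral_cmult [symmetric]) (auto intro!: nn_integral_cong simp: ennreal_mult mult_ac)
  finally show ?thesis .
qed

text \<open>Since the kernel integrates to one, \<open>f x\<close> is itself an average of a constant, and the difference
  is \<open>\<integral> (f z - f x) k(x - z) dz\<close>. Where \<open>f z * k (x - z)\<close> is not integrable in \<open>z\<close>, the mean is the default
  value 0 but the right-hand side is infinite.\<close>

lemma kernel_average_diff_le:
  fixes k f :: "'a::euclidean_space \<Rightarrow> real"
  assumes [measurable]: "k \<in> borel_measurable borel" "f \<in> borel_measurable borel"
    and k: "\<And>y. 0 \<le> k y" and f: "\<And>x. 0 \<le> f x"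
    and k1: "(\<integral>\<^sup>+y. ennreal (k y) \<partial>lborel) = 1"
  shows "ennreal \<bar>(\<integral>z. k (x - z) \<partial>density lborel f) - f x\<bar>
    \<le> (\<integral>\<^sup>+y. ennreal (\<bar>f (x - y) - f x\<bar> * k y) \<partial>lborel)"
proof -
  let ?h = "\<lambda>z. (f z - f x) * k (x - z)"
  \<comment> \<open>The substitution \<open>y = x - z\<close>.\<close>
  have refl: "(\<integral>\<^sup>+y. u y \<partial>lborel) = (\<integral>\<^sup>+z. u (x - z) \<partial>lborel)"
    if "u \<in> borel_measurable borel" for u :: "'a \<Rightarrow> ennreal"
    using nn_integral_lborel_affine[OF that, of "-1" x] by simp
  have eq: "(\<integral>\<^sup>+y. ennreal (\<bar>f (x - y) - f x\<bar> * k y) \<partial>lborel) = (\<integral>\<^sup>+z. ennreal \<bar>?h z\<bar> \<partial>lborel)"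
    by (subst refl) (auto simp: abs_mult k)
  show ?thesis
  proof (cases "(\<integral>\<^sup>+z. ennreal \<bar>?h z\<bar> \<partial>lborel) = \<infinity>")
    case False
    have ih: "integrable lborel ?h"
      using False by (intro integrableI_bounded) (auto simp: less_top)
    have k1': "(\<integral>\<^sup>+z. ennreal (k (x - z)) \<partial>lborel) = ennreal 1"
      using k1 refl[of "\<lambda>y. ennreal (k y)"] by simp
    have ik: "integrable lborel (\<lambda>z. k (x - z))"
      using k1' k by (intro integrableI_bounded) auto
    have Ik: "(\<integral>z. k (x - z) \<partial>lborel) = 1"
      using k by (intro integral_eq_nn_integral[THEN trans]) (auto simp: k1')
    have "(\<integral>z. k (x - z) \<partial>density lborel f) = (\<integral>z. f z *\<^sub>R k (x - z) \<partial>lborel)"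
      by (intro integral_density) (auto simp: f)
    also have "\<dots> = (\<integral>z. ?h z + f x * k (x - z) \<partial>lborel)"
      by (intro Bochner_Integration.integral_cong) (auto simp: algebra_simps)
    also have "\<dots> = (\<integral>z. ?h z \<partial>lborel) + f x"
      using ih ik Ik by (subst Bochner_Integration.integral_add) auto
    finally show ?thesis
      using integral_norm_bound_ennreal[OF ih] eq by simp
  qed (simp add: eq)
qed

text \<open>Minkowski's integral inequality for the smoothing error. Jensen's inequality with weight \<open>k\<close>
  would require the moment of order \<open>\<alpha> p\<close>; with weight \<open>|y|^\<alpha> k(y)\<close>, and the integrand divided by \<open>|y|^\<alpha>\<close>,
  only the moment of order \<open>\<alpha>\<close> enters.\<close>

lemma kernel_average_Lp_le:
  fixes k f :: "'a::euclidean_space \<Rightarrow> real" and p \<alpha> W K :: real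
  assumes p: "p > 1" and W: "W > 0" and K: "K \<ge> 0"
    and [measurable]: "k \<in> borel_measurable borel" "f \<in> borel_measurable borel"
    and k: "\<And>y. 0 \<le> k y" and f: "\<And>x. 0 \<le> f x"
    and k1: "(\<integral>\<^sup>+y. ennreal (k y) \<partial>lborel) = 1"
    and moment: "(\<integral>\<^sup>+y. ennreal (norm y powr \<alpha> * k y) \<partial>lborel) \<le> ennreal W"
    and lip: "\<And>y. (\<integral>\<^sup>+x. ennreal (\<bar>f (x - y) - f x\<bar> powr p) \<partial>lborel) \<le> ennreal ((K * norm y powr \<alpha>) powr p)"
  shows "(\<integral>\<^sup>+x. ennreal (\<bar>(\<integral>z. k (x - z) \<partial>density lborel f) - f x\<bar> powr p) \<partial>lborel)
    \<le> ennreal ((K * W) powr p)"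
proof -
  define w where "w = (\<lambda>y. norm y powr \<alpha> * k y)"
  define h where "h = (\<lambda>x y. \<bar>f (x - y) - f x\<bar> * norm y powr (- \<alpha>))"
  have [measurable]: "w \<in> borel_measurable borel" "(\<lambda>(x, y). h x y) \<in> borel_measurable (borel \<Otimes>\<^sub>M borel)"
    unfolding w_def h_def by measurable
  have w: "0 \<le> w y" for y using k by (simp add: w_def)
  have hw: "h x y * w y = \<bar>f (x - y) - f x\<bar> * k y" for x y
    \<comment> \<open>At \<open>y = 0\<close> the weight vanishes, and so does \<open>f (x - y) - f x\<close>.\<close>
    by (cases "y = 0") (auto simp: h_def w_def powr_minus field_simps)
  have "(\<integral>\<^sup>+x. ennreal (\<bar>(\<integral>z. k (x - z) \<partial>density lborel f) - f x\<bar> powr p) \<partial>lborel)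
    \<le> (\<integral>\<^sup>+x. ennreal (W powr (p - 1)) * (\<integral>\<^sup>+y. ennreal (h x y powr p * w y) \<partial>lborel) \<partial>lborel)"
  proof (intro nn_integral_mono powr_le_weighted_nn_integral p W)
    fix x
    show "ennreal \<bar>(\<integral>z. k (x - z) \<partial>density lborel f) - f x\<bar> \<le> (\<integral>\<^sup>+y. ennreal (h x y * w y) \<partial>lborel)"
      unfolding hw by (intro kernel_average_diff_le k f k1) measurable
    show "(\<integral>\<^sup>+y. ennreal (w y) \<partial>lborel) \<le> ennreal W" using moment by (simp add: w_def)
    show "h x \<in> borel_measurable lborel" by measurable
  qed (auto simp: w, auto simp: h_def)
  also have "\<dots> = ennreal (W powr (p - 1)) * (\<integral>\<^sup>+x. (\<integral>\<^sup>+y. ennreal (h x y powr p * w y) \<partial>lborel) \<partial>lborel)"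
    by (rule nn_integral_cmult) measurable
  also have "(\<integral>\<^sup>+x. (\<integral>\<^sup>+y. ennreal (h x y powr p * w y) \<partial>lborel) \<partial>lborel)
      = (\<integral>\<^sup>+y. (\<integral>\<^sup>+x. ennreal (h x y powr p * w y) \<partial>lborel) \<partial>lborel)"
    by (rule lborel_pair.Fubini') measurable
  also have "\<dots> \<le> (\<integral>\<^sup>+y. ennreal (K powr p) * ennreal (w y) \<partial>lborel)"
  proof (intro nn_integral_mono)
    fix y :: 'a
    have "(\<integral>\<^sup>+x. ennreal (h x y powr p * w y) \<partial>lborel)
        = (\<integral>\<^sup>+x. ennreal (norm y powr (- \<alpha> * p) * w y) * ennreal (\<bar>f (x - y) - f x\<bar> powr p) \<partial>lborel)"
      using w by (intro nn_integral_cong)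
        (simp add: ennreal_mult [symmetric] h_def powr_mult powr_powr mult_ac)
    also have "\<dots> = ennreal (norm y powr (- \<alpha> * p) * w y) * (\<integral>\<^sup>+x. ennreal (\<bar>f (x - y) - f x\<bar> powr p) \<partial>lborel)"
      by (rule nn_integral_cmult) measurable
    also have "\<dots> \<le> ennreal (norm y powr (- \<alpha> * p) * w y) * ennreal ((K * norm y powr \<alpha>) powr p)"
      by (intro mult_left_mono lip) auto
    also have "\<dots> = ennreal (norm y powr (- \<alpha> * p) * w y * (K * norm y powr \<alpha>) powr p)"
      using w by (simp add: ennreal_mult)
    also have "\<dots> \<le> ennreal (K powr p * w y)"
    proof (cases "y = 0")
      case False
      then have "norm y powr (- \<alpha> * p) * norm y powr (\<alpha> * p) = 1"
        by (simp add: powr_add [symmetric])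
      then have "norm y powr (- \<alpha> * p) * w y * (K * norm y powr \<alpha>) powr p = K powr p * w y"
        using K by (simp add: powr_mult powr_powr mult_ac)
      then show ?thesis by (simp only:)
    qed (use w in simp)
    also have "\<dots> = ennreal (K powr p) * ennreal (w y)" using w by (simp add: ennreal_mult)
    finally show "(\<integral>\<^sup>+x. ennreal (h x y powr p * w y) \<partial>lborel) \<le> ennreal (K powr p) * ennreal (w y)" .
  qed
  also have "\<dots> = ennreal (K powr p) * (\<integral>\<^sup>+y. ennreal (w y) \<partial>lborel)"
    by (rule nn_integral_cmult) measurable
  also have "\<dots> \<le> ennreal (K powr p) * ennreal W"
    using moment by (intro mult_left_mono) (auto simp: w_def)
  also have "ennreal (W powr (p - 1)) * (ennreal (K powr p) * ennreal W) = ennreal ((K * W) powr p)"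
    using W K by (simp add: ennreal_mult [symmetric] powr_mult powr_diff)
  finally show ?thesis by (simp add: mult_left_mono)
qed

section \<open>Approximation by finite location-scale mixtures\<close>

text \<open>This trades the norm for the integral of the \<open>p\<close>-th power with respect to \<open>lborel\<close>, where
  Tonelli's theorem and changes of variables apply.\<close>

lemma Lp_norm_le_iff:
  fixes f :: "real ^ 'n \<Rightarrow> real"
  assumes p: "p > 0" and c: "c \<ge> 0"
  shows "Lp_norm p f \<le> ennreal c \<longleftrightarrow> (\<integral>\<^sup>+x. ennreal (\<bar>f x\<bar> powr p) \<partial>lborel) \<le> ennreal (c powr p)"
proof -
  let ?I = "\<integral>\<^sup>+x. ennreal (\<bar>f x\<bar> powr p) \<partial>lborel"
  have eq: "(\<integral>\<^sup>+x. ennreal (\<bar>f x\<bar> powr p) \<partial>lebesgue) = ?I" by (rule nn_integral_completion)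
  show ?thesis
  proof (cases ?I rule: ennreal_cases)
    case (real r)
    have "r powr (1 / p) \<le> c \<longleftrightarrow> r \<le> c powr p"
    proof
      assume "r powr (1 / p) \<le> c"
      then have "(r powr (1 / p)) powr p \<le> c powr p" using p by (intro powr_mono2) auto
      then show "r \<le> c powr p" using p real by (simp add: powr_powr)
    next
      assume "r \<le> c powr p"
      then have "r powr (1 / p) \<le> (c powr p) powr (1 / p)" using p real by (intro powr_mono2) auto
      then show "r powr (1 / p) \<le> c" using p c by (simp add: powr_powr)
    qed
    then show ?thesis using real c by (simp add: Lp_norm_def eq)
  next
    case top
    then show ?thesis by (simp add: Lp_norm_def eq top_unique)
  qed
qed

lemma Lp_norm_cong_AE:
  fixes f g :: "real ^ 'n \<Rightarrow> real"
  assumes "AE x in lborel. f x = g x"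
  shows "Lp_norm p f = Lp_norm p g"
proof -
  have "(\<integral>\<^sup>+x. ennreal (\<bar>f x\<bar> powr p) \<partial>lborel) = (\<integral>\<^sup>+x. ennreal (\<bar>g x\<bar> powr p) \<partial>lborel)"
    using assms by (intro nn_integral_cong_AE) auto
  then show ?thesis by (simp add: Lp_norm_def nn_integral_completion)
qed

lemma density_borel_version:
  fixes f :: "real ^ 'n \<Rightarrow> real"
  assumes "f \<in> prob_densities"
  obtains g where "g \<in> borel_measurable borel" "\<And>x. 0 \<le> g x" "AE x in lborel. f x = g x"
    "(\<integral>\<^sup>+x. ennreal (g x) \<partial>lborel) = 1"
proof -
  have f: "f \<in> borel_measurable lebesgue" "\<And>x. 0 \<le> f x" "(\<integral>\<^sup>+x. ennreal (f x) \<partial>lborel) = 1"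
    using assms by (auto simp: prob_densities_def nn_integral_completion)
  obtain g where g: "g \<in> borel_measurable lborel" "AE x in lborel. f x = g x"
    using completion_ex_borel_measurable_real[OF f(1)] by blast
  have ae: "AE x in lborel. f x = max 0 (g x)"
    using g(2) by (rule AE_mp) (use f in \<open>auto intro!: AE_I2 simp: max_def\<close>, metis)
  show ?thesis
  proof (rule that[of "\<lambda>x. max 0 (g x)"])
    have "(\<integral>\<^sup>+x. ennreal (max 0 (g x)) \<partial>lborel) = (\<integral>\<^sup>+x. ennreal (f x) \<partial>lborel)"
      using ae by (intro nn_integral_cong_AE) auto
    then show "(\<integral>\<^sup>+x. ennreal (max 0 (g x)) \<partial>lborel) = 1" using f by simp
  qed (use g ae in auto)
qed

lemma AE_dilation_eq:
  fixes f g :: "real ^ 'n \<Rightarrow> real"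
  assumes ae: "AE x in lborel. f x = g x" and \<nu>: "\<nu> > 0"
  shows "AE x in lborel. dilation f \<nu> (x - \<mu>) = dilation g \<nu> (x - \<mu>)"
proof -
  have "AE x in lborel. f (- (\<nu> *\<^sub>R \<mu>) + \<nu> *\<^sub>R x) = g (- (\<nu> *\<^sub>R \<mu>) + \<nu> *\<^sub>R x)"
    using AE_lborel_affine[OF ae, of \<nu> "- (\<nu> *\<^sub>R \<mu>)"] \<nu> by simp
  then show ?thesis by (simp add: dilation_def scaleR_diff_right)
qed

text \<open>Bias plus sampling error at a fixed scale \<open>\<nu>\<close>, where all weights are \<open>1/n\<close> and the locations come
  from sampling the law with density \<open>f\<close>.\<close>

lemma mixture_approximation_borel:
  fixes \<phi> f :: "real ^ 'n \<Rightarrow> real" and p \<alpha> K1 K2 C B r \<nu> :: real and n :: nat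
  assumes p: "p > 1" and pos: "K1 > 0" "K2 > 0" "C > 0" "B \<ge> 0" "n \<ge> 1" "\<nu> > 0"
    and smooth: "\<And>a b. \<bar>a + b\<bar> powr p \<le> (1 + C / n) * \<bar>a\<bar> powr p
      + p * signed_powr (p - 1) a * b + C * real n powr (r - 1) * \<bar>b\<bar> powr p"
    and \<phi>_meas [measurable]: "\<phi> \<in> borel_measurable borel" and \<phi>: "\<And>x. 0 \<le> \<phi> x"
    and \<phi>1: "(\<integral>\<^sup>+x. ennreal (\<phi> x) \<partial>lborel) = 1"
    and \<phi>p: "(\<integral>\<^sup>+x. ennreal (\<bar>\<phi> x\<bar> powr p) \<partial>lborel) \<le> ennreal B"
    and moment: "(\<integral>\<^sup>+x. ennreal (norm x powr \<alpha> * \<phi> x) \<partial>lborel) \<le> ennreal K1"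
    and f_meas [measurable]: "f \<in> borel_measurable borel" and f: "\<And>x. 0 \<le> f x"
    and f1: "(\<integral>\<^sup>+x. ennreal (f x) \<partial>lborel) = 1"
    and lip: "\<And>y. (\<integral>\<^sup>+x. ennreal (\<bar>f (x - y) - f x\<bar> powr p) \<partial>lborel) \<le> ennreal ((K2 * norm y powr \<alpha>) powr p)"
  shows "\<exists>\<mu> :: nat \<Rightarrow> real ^ 'n.
    (\<integral>\<^sup>+x. ennreal (\<bar>(\<Sum>j=1..n. (1 / n) * dilation \<phi> \<nu> (x - \<mu> j)) - f x\<bar> powr p) \<partial>lborel)
    \<le> ennreal (2 powr p * ((1 / n) powr p * (C * exp C * (2 powr p * 2) * real n powr r * (\<nu> powr (CARD('n) * (p - 1)) * B))
        + (K2 * (\<nu> powr (- \<alpha>) * K1)) powr p))"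
proof -
  let ?M = "density lborel (\<lambda>x. ennreal (f x))"
  let ?F = "\<lambda>\<mu> x. dilation \<phi> \<nu> (x - \<mu>)"
  define g where "g = (\<lambda>x. \<integral>\<mu>. ?F \<mu> x \<partial>?M)"
  define B' where "B' = \<nu> powr (CARD('n) * (p - 1)) * B"
  define V where "V = C * exp C * (2 powr p * 2) * real n powr r * B'"
  define W where "W = \<nu> powr (- \<alpha>) * K1"
  have nonneg: "B' \<ge> 0" "V \<ge> 0" "W > 0" using pos by (auto simp: B'_def V_def W_def)
  have dil0: "0 \<le> dilation \<phi> \<nu> x" for x using \<phi> pos by (simp add: dilation_def)
  have prob: "emeasure ?M (space ?M) = 1" using f1 by (subst emeasure_density) auto
  interpret M: finite_measure ?M by standard (use prob in simp)
  have F_meas: "(\<lambda>(\<mu>, x). ?F \<mu> x) \<in> borel_measurable (?M \<Otimes>\<^sub>M lborel)" by measurable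
  have F_meas': "(\<lambda>(x, \<mu>). ?F \<mu> x) \<in> borel_measurable (lborel \<Otimes>\<^sub>M ?M)" by measurable
  have [measurable]: "g \<in> borel_measurable borel"
    using M.borel_measurable_lebesgue_integral[OF F_meas'] by (simp add: g_def)
  have Fp: "(\<integral>\<^sup>+x. ennreal (\<bar>?F \<mu> x\<bar> powr p) \<partial>lborel) \<le> ennreal B'" for \<mu>
    using \<phi>p pos by (subst nn_integral_dilation_powr) (auto simp: B'_def ennreal_mult mult_left_mono)
  obtain \<mu> :: "nat \<Rightarrow> real ^ 'n" where
    \<mu>: "(\<integral>\<^sup>+x. ennreal (\<bar>\<Sum>j=1..n. ?F (\<mu> j) x - g x\<bar> powr p) \<partial>lborel) \<le> ennreal V"
    using sampling_bound[OF p prob _ F_meas pos(3) nonneg(1) pos(5) smooth Fp]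
    unfolding g_def V_def by (auto simp: lborel.sigma_finite_measure_axioms)
  have "(\<integral>\<^sup>+y. ennreal (norm y powr \<alpha> * dilation \<phi> \<nu> y) \<partial>lborel)
      = ennreal (\<nu> powr (- \<alpha>)) * (\<integral>\<^sup>+x. ennreal (norm x powr \<alpha> * \<phi> x) \<partial>lborel)"
    by (intro nn_integral_norm_powr_dilation \<phi> pos) measurable
  also have "\<dots> \<le> ennreal (\<nu> powr (- \<alpha>)) * ennreal K1" by (intro mult_left_mono moment) auto
  also have "\<dots> = ennreal W" using pos by (simp add: W_def ennreal_mult)
  finally have mom: "(\<integral>\<^sup>+y. ennreal (norm y powr \<alpha> * dilation \<phi> \<nu> y) \<partial>lborel) \<le> ennreal W" .
  have dil1: "(\<integral>\<^sup>+y. ennreal (dilation \<phi> \<nu> y) \<partial>lborel) = 1"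
    using nn_integral_dilation[of \<phi> "\<lambda>_. 1" \<nu>] pos \<phi>1 by simp
  have bias: "(\<integral>\<^sup>+x. ennreal (\<bar>g x - f x\<bar> powr p) \<partial>lborel) \<le> ennreal ((K2 * W) powr p)"
    unfolding g_def
    by (rule kernel_average_Lp_le[where \<alpha> = \<alpha>]) (use p nonneg pos dil0 f dil1 mom lip in auto)
  have "(\<integral>\<^sup>+x. ennreal (\<bar>(\<Sum>j=1..n. (1 / n) * ?F (\<mu> j) x) - f x\<bar> powr p) \<partial>lborel)
    \<le> (\<integral>\<^sup>+x. ennreal (2 powr p) * (ennreal ((1 / n) powr p) * ennreal (\<bar>\<Sum>j=1..n. ?F (\<mu> j) x - g x\<bar> powr p)
        + ennreal (\<bar>g x - f x\<bar> powr p)) \<partial>lborel)"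
  proof (intro nn_integral_mono)
    fix x
    have "(\<Sum>j=1..n. (1 / n) * ?F (\<mu> j) x) - f x
        = (1 / n) * (\<Sum>j=1..n. ?F (\<mu> j) x - g x) + (g x - f x)"
      using pos by (simp add: sum_subtractf right_diff_distrib sum_distrib_left)
    then have "\<bar>(\<Sum>j=1..n. (1 / n) * ?F (\<mu> j) x) - f x\<bar> powr p
      \<le> 2 powr p * (\<bar>(1 / n) * (\<Sum>j=1..n. ?F (\<mu> j) x - g x)\<bar> powr p + \<bar>g x - f x\<bar> powr p)"
      using abs_add_powr_le[of p] p by (simp only:)
    also have "\<bar>(1 / n) * (\<Sum>j=1..n. ?F (\<mu> j) x - g x)\<bar> powr p
        = (1 / n) powr p * \<bar>\<Sum>j=1..n. ?F (\<mu> j) x - g x\<bar> powr p"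
      by (subst abs_mult, subst powr_mult) auto
    finally show "ennreal (\<bar>(\<Sum>j=1..n. (1 / n) * ?F (\<mu> j) x) - f x\<bar> powr p)
      \<le> ennreal (2 powr p) * (ennreal ((1 / n) powr p) * ennreal (\<bar>\<Sum>j=1..n. ?F (\<mu> j) x - g x\<bar> powr p)
        + ennreal (\<bar>g x - f x\<bar> powr p))"
      by (simp add: ennreal_mult [symmetric] ennreal_plus [symmetric] ennreal_leI del: ennreal_plus)
  qed
  also have "\<dots> = ennreal (2 powr p) * (ennreal ((1 / n) powr p)
      * (\<integral>\<^sup>+x. ennreal (\<bar>\<Sum>j=1..n. ?F (\<mu> j) x - g x\<bar> powr p) \<partial>lborel)
      + (\<integral>\<^sup>+x. ennreal (\<bar>g x - f x\<bar> powr p) \<partial>lborel))"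
    by (simp add: nn_integral_cmult nn_integral_add)
  also have "\<dots> \<le> ennreal (2 powr p) * (ennreal ((1 / n) powr p) * ennreal V + ennreal ((K2 * W) powr p))"
    by (intro mult_left_mono add_mono \<mu> bias) auto
  also have "\<dots> = ennreal (2 powr p * ((1 / n) powr p * V + (K2 * W) powr p))"
    using nonneg by (simp add: ennreal_mult ennreal_plus)
  finally show ?thesis unfolding V_def B'_def W_def by blast
qed

text \<open>Passage from Lebesgue measurable to Borel densities, and choice of the scale \<open>\<nu> = m^\<beta>\<close>. The
  two equations for \<open>\<beta>\<close> and \<open>\<rho>\<close> say that bias and sampling error both decay like \<open>m^(-\<rho>)\<close>.\<close>

lemma mixture_approximation:
  fixes \<phi> f0 :: "real ^ 'n \<Rightarrow> real" and p \<alpha> K1 K2 C B r \<beta> \<rho> :: real and m :: nat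
  assumes p: "p > 1" and pos: "K1 > 0" "K2 > 0" "C > 0" "B \<ge> 0" and m: "m \<ge> 1"
    and smooth: "\<And>a b. \<bar>a + b\<bar> powr p \<le> (1 + C / m) * \<bar>a\<bar> powr p
      + p * signed_powr (p - 1) a * b + C * real m powr (r - 1) * \<bar>b\<bar> powr p"
    and \<phi>: "\<phi> \<in> prob_densities"
    and \<phi>p: "Lp_norm p \<phi> \<le> ennreal B"
    and moment: "(\<integral>\<^sup>+x. ennreal (norm x powr \<alpha> * \<phi> x) \<partial>lborel) \<le> ennreal K1"
    and f0: "f0 \<in> prob_densities"
    and lip: "\<And>y. Lp_norm p (\<lambda>x. f0 (x - y) - f0 x) \<le> ennreal (K2 * norm y powr \<alpha>)"
    and bias_rate: "\<alpha> * \<beta> = \<rho>" and variance_rate: "r - p + \<beta> * (CARD('n) * (p - 1)) = - \<rho> * p"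
  shows "\<exists>f \<in> mixtures m (location_scale \<phi>).
    Lp_norm p (\<lambda>x. f x - f0 x)
      \<le> ennreal ((2 powr p * (C * exp C * (2 powr p * 2) * B powr p + (K2 * K1) powr p)) powr (1 / p) * real m powr (- \<rho>))"
proof -
  define \<nu> where "\<nu> = real m powr \<beta>"
  have \<nu>: "\<nu> > 0" using m by (simp add: \<nu>_def)
  obtain \<phi>' where \<phi>': "\<phi>' \<in> borel_measurable borel" "\<And>x. 0 \<le> \<phi>' x" "AE x in lborel. \<phi> x = \<phi>' x"
    "(\<integral>\<^sup>+x. ennreal (\<phi>' x) \<partial>lborel) = 1" by (rule density_borel_version[OF \<phi>]) blast
  obtain f' where f': "f' \<in> borel_measurable borel" "\<And>x. 0 \<le> f' x" "AE x in lborel. f0 x = f' x"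
    "(\<integral>\<^sup>+x. ennreal (f' x) \<partial>lborel) = 1" by (rule density_borel_version[OF f0]) blast
  have "Lp_norm p \<phi>' \<le> ennreal B" using \<phi>p Lp_norm_cong_AE[OF \<phi>'(3)] by simp
  then have \<phi>'p: "(\<integral>\<^sup>+x. ennreal (\<bar>\<phi>' x\<bar> powr p) \<partial>lborel) \<le> ennreal (B powr p)"
    using p pos by (simp add: Lp_norm_le_iff)
  have "(\<integral>\<^sup>+x. ennreal (norm x powr \<alpha> * \<phi>' x) \<partial>lborel) = (\<integral>\<^sup>+x. ennreal (norm x powr \<alpha> * \<phi> x) \<partial>lborel)"
    using \<phi>'(3) by (intro nn_integral_cong_AE) auto
  then have moment': "(\<integral>\<^sup>+x. ennreal (norm x powr \<alpha> * \<phi>' x) \<partial>lborel) \<le> ennreal K1"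
    using moment by simp
  have lip': "(\<integral>\<^sup>+x. ennreal (\<bar>f' (x - y) - f' x\<bar> powr p) \<partial>lborel) \<le> ennreal ((K2 * norm y powr \<alpha>) powr p)" for y
  proof -
    have "AE x in lborel. f0 (x - y) = f' (x - y)"
      using AE_lborel_affine[OF f'(3), of 1 "- y"] by simp
    then have "Lp_norm p (\<lambda>x. f0 (x - y) - f0 x) = Lp_norm p (\<lambda>x. f' (x - y) - f' x)"
      using f'(3) by (intro Lp_norm_cong_AE) auto
    then show ?thesis
      using lip[of y] p pos by (simp add: Lp_norm_le_iff)
  qed
  have "\<exists>\<mu> :: nat \<Rightarrow> real ^ 'n.
    (\<integral>\<^sup>+x. ennreal (\<bar>(\<Sum>j=1..m. (1 / m) * dilation \<phi>' \<nu> (x - \<mu> j)) - f' x\<bar> powr p) \<partial>lborel)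
    \<le> ennreal (2 powr p * ((1 / m) powr p * (C * exp C * (2 powr p * 2) * real m powr r * (\<nu> powr (CARD('n) * (p - 1)) * B powr p))
        + (K2 * (\<nu> powr (- \<alpha>) * K1)) powr p))"
    by (rule mixture_approximation_borel[OF p pos(1-3) _ m \<nu> smooth \<phi>'(1,2,4) \<phi>'p moment' f'(1,2,4) lip']) simp_all
  then obtain \<mu> :: "nat \<Rightarrow> real ^ 'n" where \<mu>:
    "(\<integral>\<^sup>+x. ennreal (\<bar>(\<Sum>j=1..m. (1 / m) * dilation \<phi>' \<nu> (x - \<mu> j)) - f' x\<bar> powr p) \<partial>lborel)
    \<le> ennreal (2 powr p * ((1 / m) powr p * (C * exp C * (2 powr p * 2) * real m powr r * (\<nu> powr (CARD('n) * (p - 1)) * B powr p))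
        + (K2 * (\<nu> powr (- \<alpha>) * K1)) powr p))" (is "_ \<le> ennreal ?R") by blast
  define T where "T = 2 powr p * (C * exp C * (2 powr p * 2) * B powr p + (K2 * K1) powr p)"
  have T: "T \<ge> 0" using pos by (simp add: T_def)
  \<comment> \<open>With \<open>\<nu> = m^\<beta>\<close> both error terms become a constant times \<open>m^(-\<rho> p)\<close>.\<close>
  have bias: "(K2 * (\<nu> powr (- \<alpha>) * K1)) powr p = (K2 * K1) powr p * real m powr (- \<rho> * p)"
    using pos bias_rate by (simp add: \<nu>_def powr_mult powr_powr mult_ac)
  have "(1 / m) powr p * real m powr r * \<nu> powr (CARD('n) * (p - 1))
      = real m powr (r - p + \<beta> * (CARD('n) * (p - 1)))"
    using m by (simp add: \<nu>_def powr_powr powr_add powr_diff powr_divide)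
  then have var: "(1 / m) powr p * real m powr r * \<nu> powr (CARD('n) * (p - 1)) = real m powr (- \<rho> * p)"
    unfolding variance_rate .
  have "?R = 2 powr p * (C * exp C * (2 powr p * 2) * B powr p
      * ((1 / m) powr p * real m powr r * \<nu> powr (CARD('n) * (p - 1))) + (K2 * (\<nu> powr (- \<alpha>) * K1)) powr p)"
    by (simp add: mult_ac)
  also have "\<dots> = T * real m powr (- \<rho> * p)"
    unfolding var bias T_def by (simp add: algebra_simps)
  also have "\<dots> = (T powr (1 / p) * real m powr (- \<rho>)) powr p"
    using T p by (simp add: powr_mult powr_powr)
  finally have R: "?R = (T powr (1 / p) * real m powr (- \<rho>)) powr p" .
  let ?f = "\<lambda>x. \<Sum>j=1..m. (1 / m) * dilation \<phi> \<nu> (x - \<mu> j)"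
  have "AE x in lborel. \<forall>j\<in>{1..m}. dilation \<phi> \<nu> (x - \<mu> j) = dilation \<phi>' \<nu> (x - \<mu> j)"
    by (intro AE_finite_allI AE_dilation_eq \<phi>'(3) \<nu>) simp
  then have "AE x in lborel. ?f x - f0 x = (\<Sum>j=1..m. (1 / m) * dilation \<phi>' \<nu> (x - \<mu> j)) - f' x"
    using f'(3)
  proof eventually_elim
    case (elim x)
    then have "?f x = (\<Sum>j=1..m. (1 / m) * dilation \<phi>' \<nu> (x - \<mu> j))" by (intro sum.cong) auto
    then show ?case using elim by simp
  qed
  then have "Lp_norm p (\<lambda>x. ?f x - f0 x) = Lp_norm p (\<lambda>x. (\<Sum>j=1..m. (1 / m) * dilation \<phi>' \<nu> (x - \<mu> j)) - f' x)"
    by (rule Lp_norm_cong_AE)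
  also have "\<dots> \<le> ennreal (T powr (1 / p) * real m powr (- \<rho>))"
    using \<mu> p unfolding R by (subst Lp_norm_le_iff) auto
  finally have "Lp_norm p (\<lambda>x. ?f x - f0 x) \<le> ennreal (T powr (1 / p) * real m powr (- \<rho>))" .
  moreover have "?f \<in> mixtures m (location_scale \<phi>)"
    unfolding mixtures_def location_scale_def
    using m \<nu> by (intro CollectI exI[of _ "\<lambda>_. 1 / real m"] exI[of _ "\<lambda>j x. dilation \<phi> \<nu> (x - \<mu> j)"]) auto
  ultimately show ?thesis unfolding T_def by (intro bexI[of _ ?f])
qed

theorem corollary4:
  fixes p q \<alpha> K1 K2 :: real
    and \<phi> :: "real ^ 'n \<Rightarrow> real"
  assumes "1 < p"
    and "q = p / (p - 1)"
    and "\<alpha> > 0" "K1 > 0" "K2 > 0"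
    and "\<phi> \<in> Lp_functions p \<inter> prob_densities"
    and "(\<integral>\<^sup>+ x. ennreal (norm x powr \<alpha> * \<phi> x) \<partial>lebesgue) \<le> ennreal K1"
  shows "\<exists>K\<ge>0. \<forall>f0 :: real ^ 'n \<Rightarrow> real.
     f0 \<in> Lp_functions p \<inter> prob_densities \<longrightarrow>
     (\<forall>y. Lp_norm p (\<lambda>x. f0 (x - y) - f0 x) \<le> ennreal (K2 * norm y powr \<alpha>)) \<longrightarrow>
     (\<exists>f :: nat \<Rightarrow> real ^ 'n \<Rightarrow> real. \<forall>m\<ge>1.
        f m \<in> mixtures m (location_scale \<phi>) \<and>
        Lp_norm p (\<lambda>x. f m x - f0 x) \<le>
          (if p < 2
           then ennreal (K * real m powr (- (\<alpha> / (\<alpha> * q + real CARD('n)))))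
           else ennreal (K * real m powr (- (\<alpha> * q / (2 * (\<alpha> * q + real CARD('n))))))))"
proof -
  obtain C where C: "C > 0" and smooth: "\<And>a b (n::nat). n \<ge> 1 \<Longrightarrow>
      \<bar>a + b\<bar> powr p \<le> (1 + C / n) * \<bar>a\<bar> powr p
      + p * signed_powr (p - 1) a * b + C * real n powr (max 1 (p / 2) - 1) * \<bar>b\<bar> powr p"
    using powr_smoothness[OF \<open>1 < p\<close>] by blast
  have "Lp_norm p \<phi> < \<infinity>" and \<phi>: "\<phi> \<in> prob_densities"
    using assms by (auto simp: Lp_functions_def)
  then obtain B where B: "B \<ge> 0" "Lp_norm p \<phi> = ennreal B"
    by (cases "Lp_norm p \<phi>" rule: ennreal_cases) auto
  define K where "K = (2 powr p * (C * exp C * (2 powr p * 2) * B powr p + (K2 * K1) powr p)) powr (1 / p)"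
  define s where "s = \<alpha> * q + real CARD('n)"
  have q: "q * (p - 1) = p" "q > 0" using assms(1,2) by auto
  have s: "s > 0" using assms(3) q by (simp add: s_def add_pos_nonneg)
  define \<beta> where "\<beta> = (if p < 2 then 1 / s else q / (2 * s))"
  define \<rho> where "\<rho> = (if p < 2 then \<alpha> / s else \<alpha> * q / (2 * s))"
  have bias_rate: "\<alpha> * \<beta> = \<rho>" by (simp add: \<beta>_def \<rho>_def)
  \<comment> \<open>The variance rate only involves \<open>d\<close> through \<open>d (p - 1)\<close>, and \<open>q (p - 1) = p\<close>.\<close>
  have d: "real CARD('n) * (p - 1) = s * (p - 1) - \<alpha> * p"
  proof -
    have "s * (p - 1) = \<alpha> * (q * (p - 1)) + real CARD('n) * (p - 1)"
      by (simp add: s_def algebra_simps)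
    then show ?thesis by (simp add: q)
  qed
  have variance_rate: "max 1 (p / 2) - p + \<beta> * (CARD('n) * (p - 1)) = - \<rho> * p"
  proof (cases "p < 2")
    case True
    then show ?thesis unfolding d using s by (simp add: \<beta>_def \<rho>_def field_simps)
  next
    case False
    have "\<beta> * (s * (p - 1) - \<alpha> * p) = q * (p - 1) / 2 - q / (2 * s) * \<alpha> * p"
      using False s by (simp add: \<beta>_def field_simps)
    then show ?thesis unfolding d using False s q by (simp add: \<rho>_def)
  qed
  have rate: "(if p < 2 then ennreal (K * real m powr (- (\<alpha> / (\<alpha> * q + real CARD('n)))))
      else ennreal (K * real m powr (- (\<alpha> * q / (2 * (\<alpha> * q + real CARD('n)))))))
      = ennreal (K * real m powr (- \<rho>))" for m
    by (simp add: \<rho>_def s_def)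
  have moment: "(\<integral>\<^sup>+x. ennreal (norm x powr \<alpha> * \<phi> x) \<partial>lborel) \<le> ennreal K1"
    using assms(7) by (simp add: nn_integral_completion)
  have main: "\<exists>f. \<forall>m\<ge>1. f m \<in> mixtures m (location_scale \<phi>) \<and>
      Lp_norm p (\<lambda>x. f m x - f0 x) \<le> ennreal (K * real m powr (- \<rho>))"
    if "f0 \<in> Lp_functions p \<inter> prob_densities"
      and "\<forall>y. Lp_norm p (\<lambda>x. f0 (x - y) - f0 x) \<le> ennreal (K2 * norm y powr \<alpha>)" for f0
  proof -
    have "\<exists>f. m \<ge> 1 \<longrightarrow> f \<in> mixtures m (location_scale \<phi>) \<and>
      Lp_norm p (\<lambda>x. f x - f0 x) \<le> ennreal (K * real m powr (- \<rho>))" for m :: nat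
    proof (cases "m \<ge> 1")
      case True
      have "\<exists>f \<in> mixtures m (location_scale \<phi>). Lp_norm p (\<lambda>x. f x - f0 x) \<le> ennreal (K * real m powr (- \<rho>))"
        unfolding K_def
        by (rule mixture_approximation[OF \<open>1 < p\<close> \<open>K1 > 0\<close> \<open>K2 > 0\<close> C B(1) True smooth[OF True] \<phi> _ moment _ _
              bias_rate variance_rate]) (use that B in auto)
      then show ?thesis by blast
    qed simp
    then show ?thesis by metis
  qed
  show ?thesis
    by (intro exI[of _ K] conjI allI impI, simp add: K_def) (subst rate, rule main)
qed

end
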